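(* Let $L$ be an étale $F$-algebra of dimension $n\ge 1$, let $A$ be a central simple $F$-algebra of degree $n$, and let $\varepsilon\colon L\hookrightarrow A$ be an $F$-algebra embedding. For $\xi\in\mathbf{X}(L)=\operatorname{Hom}_{F\text{-alg}}(L,F_s)$ set $$\varepsilon_*(\xi)=\{x\in A_s\mid (1\otimes\xi(\ell))\cdot x=(\varepsilon(\ell)\otimes 1)\cdot x\ \text{ for all }\ell\in L\}.$$ Then each right ideal $\varepsilon_*(\xi)$ of $A_s$ is $n$-dimensional over $F_s$, and $\varepsilon_*$ is a general embedding $$\varepsilon_*\colon \mathbf{X}(L)\hookrightarrow\mathcal{SB}(A).$$
   Context: $F$ is an arbitrary field, $F_s$ a separable closure of $F$, $\Gamma=\operatorname{Gal}(F_s/F)$, and $A_s=A\otimes_F F_s$. An étale $F$-algebra of dimension $n$ is a commutative $F$-algebra $L$ with $L\otimes_FF_s\cong F_s^n$. The set $\mathbf{X}(L)=\operatorname{Hom}_{F\text{-alg}}(L,F_s)$ has $n$ elements and carries the $\Gamma$-action $({}^\gamma\xi)(\ell)=\gamma(\xi(\ell))$. For a central simple $F$-algebra $A$ of degree $n$, $\mathcal{SB}(A)$ is the $(n-1)$-dimensional projective space over $F_s$ whose $(k-1)$-dimensional linear varieties are the right ideals of $A_s$ of $F_s$-dimension $nk$, for $1\le k\le n$ (so its points are the $n$-dimensional right ideals). If $A_s\cong\operatorname{End}_{F_s}(V)$, the right ideal $\operatorname{Hom}_{F_s}(V,U)$ corresponds to the linear subspace $U\subset V$, so $\mathcal{SB}(A)$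 is identified with $\mathbb{P}(V)$. The group $\Gamma$ acts on $A_s$ through the second factor, hence on $\mathcal{SB}(A)$. For a $\Gamma$-set $X$ of $n$ elements (finite set with continuous $\Gamma$-action), a general embedding $X\hookrightarrow\mathcal{SB}(A)$ is an injective $\Gamma$-equivariant map from $X$ to the set of points of $\mathcal{SB}(A)$ whose image consists of $n$ points in general position, i.e. not contained in a proper linear subspace (equivalently, the corresponding $n$ right ideals have sum $A_s$). *)

theory Defs
  imports
    "HOL-Analysis.Function_Topology"
    "HOL-Analysis.Product_Topology"
    "HOL-Algebra.Algebra"
    "HOL-Algebra.Algebraic_Closure_Type"
    "HOL-Computational_Algebra.Polynomial"
    "HOL-Library.Poly_Mapping"
begin

section \<open>Algebras over a field\<close>

text \<open>
  The base field, its separable closure and the algebras are types, with the scalar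
  multiplication by the base field as a parameter. Tensor products depend on this parameter,
  so they cannot be types; they are rings with an explicit carrier in the sense of HOL-Algebra.
\<close>

locale assoc_algebra = vector_space scale
  for scale :: "'f::field \<Rightarrow> 'a::ring_1 \<Rightarrow> 'a" +
  assumes scale_mult_left: "scale r x * y = scale r (x * y)"
    and scale_mult_right: "x * scale r y = scale r (x * y)"

definition algebra_hom ::
  "('f::field \<Rightarrow> 'a::ring_1 \<Rightarrow> 'a) \<Rightarrow> ('f \<Rightarrow> 'b::ring_1 \<Rightarrow> 'b) \<Rightarrow> ('a \<Rightarrow> 'b) \<Rightarrow> bool" where
  "algebra_hom scA scB h \<longleftrightarrow>
     Vector_Spaces.linear scA scB h \<and> h 1 = 1 \<and> (\<forall>x y. h (x * y) = h x * h y)"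

text \<open>Since \<^term>\<open>n > 0\<close>, the equation for the dimension forces finite dimension
  (\<^const>\<open>vector_space.dim\<close> is 0 for infinite-dimensional spaces).
  The zero ring is excluded by the type class.\<close>

definition central_simple :: "('f::field \<Rightarrow> 'a::ring_1 \<Rightarrow> 'a) \<Rightarrow> nat \<Rightarrow> bool" where
  "central_simple scA n \<longleftrightarrow>
     assoc_algebra scA \<and> n > 0 \<and> vector_space.dim scA UNIV = n\<^sup>2 \<and>
     {z. \<forall>x. z * x = x * z} = range (\<lambda>r. scA r 1) \<and>
     (\<forall>I. ideal I (ring_of_type_algebra :: 'a ring) \<longrightarrow> I = {0} \<or> I = UNIV)"

section \<open>Separable closure and absolute Galois group\<close>

definition separable_poly :: "'k::field poly \<Rightarrow> bool" where
  "separable_poly p \<longleftrightarrow> coprime p (pderiv p)"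

definition separable_closure :: "('f::field \<Rightarrow> 's::field \<Rightarrow> 's) \<Rightarrow> bool" where
  "separable_closure scS \<longleftrightarrow>
     assoc_algebra scS \<and>
     (\<forall>x. \<exists>p :: 'f poly. Factorial_Ring.irreducible p \<and> separable_poly p \<and>
            poly (map_poly (\<lambda>r. scS r 1) p) x = 0) \<and>
     (\<forall>q :: 's poly. separable_poly q \<and> Polynomial.degree q > 0 \<longrightarrow> (\<exists>x. poly q x = 0))"

definition galois_group :: "('f::field \<Rightarrow> 's::field \<Rightarrow> 's) \<Rightarrow> ('s \<Rightarrow> 's) monoid" where
  "galois_group scS =
     \<lparr>carrier = {\<gamma>. algebra_hom scS scS \<gamma> \<and> bij \<gamma>}, monoid.mult = (\<circ>), one = id\<rparr>"

text \<open>The Krull topology of an algebraic extension is the topology of pointwise convergence,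
  where the field is discrete: the automorphisms fixing a finite set, equivalently a finite
  subextension, form a basis of neighbourhoods of the identity.\<close>

definition krull_topology :: "('f::field \<Rightarrow> 's::field \<Rightarrow> 's) \<Rightarrow> ('s \<Rightarrow> 's) topology" where
  "krull_topology scS =
     subtopology (product_topology (\<lambda>_. discrete_topology UNIV) UNIV)
       (carrier (galois_group scS))"

definition galois_set ::
  "('f::field \<Rightarrow> 's::field \<Rightarrow> 's) \<Rightarrow> nat \<Rightarrow> 'x set \<Rightarrow> (('s \<Rightarrow> 's) \<Rightarrow> 'x \<Rightarrow> 'x) \<Rightarrow> bool" where
  "galois_set scS n S act \<longleftrightarrow>
     finite S \<and> card S = n \<and> group_action (galois_group scS) S act \<and>
     continuous_map (prod_topology (krull_topology scS) (discrete_topology S))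
       (discrete_topology S) (\<lambda>(\<gamma>, x). act \<gamma> x)"

section \<open>Tensor products of algebras\<close>

text \<open>The free abelian group on the pairs, with the product
  \<open>(a, b) (a', b') = (a a', b b')\<close> extended bilinearly.\<close>

definition pair_mult ::
  "('a::ring_1 \<times> 'b::ring_1 \<Rightarrow>\<^sub>0 int) \<Rightarrow> ('a \<times> 'b \<Rightarrow>\<^sub>0 int) \<Rightarrow> ('a \<times> 'b \<Rightarrow>\<^sub>0 int)" where
  "pair_mult f g =
     frag_extend (\<lambda>p. frag_extend (\<lambda>q. frag_of (fst p * fst q, snd p * snd q)) g) f"

definition pair_ring :: "('a::ring_1 \<times> 'b::ring_1 \<Rightarrow>\<^sub>0 int) ring" where
  "pair_ring = \<lparr>carrier = UNIV, monoid.mult = pair_mult, one = frag_of (1, 1),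
     ring.zero = 0, ring.add = (+)\<rparr>"

definition tensor_relations ::
  "('f::field \<Rightarrow> 'a::ring_1 \<Rightarrow> 'a) \<Rightarrow> ('f \<Rightarrow> 'b::ring_1 \<Rightarrow> 'b) \<Rightarrow> ('a \<times> 'b \<Rightarrow>\<^sub>0 int) set" where
  "tensor_relations scA scB =
     {frag_of (a + a', b) - frag_of (a, b) - frag_of (a', b) | a a' b. True} \<union>
     {frag_of (a, b + b') - frag_of (a, b) - frag_of (a, b') | a b b'. True} \<union>
     {frag_of (scA r a, b) - frag_of (a, scB r b) | r a b. True}"

text \<open>For algebras, the subgroup generated by the relations is already an ideal, because
  the relations are stable under multiplication by pairs. Hence the quotient below has the
  usual tensor product as its additive group.\<close>

definition tensor_ideal ::
  "('f::field \<Rightarrow> 'a::ring_1 \<Rightarrow> 'a) \<Rightarrow> ('f \<Rightarrow> 'b::ring_1 \<Rightarrow> 'b) \<Rightarrow> ('a \<times> 'b \<Rightarrow>\<^sub>0 int) set" where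
  "tensor_ideal scA scB = genideal pair_ring (tensor_relations scA scB)"

definition tensor_ring ::
  "('f::field \<Rightarrow> 'a::ring_1 \<Rightarrow> 'a) \<Rightarrow> ('f \<Rightarrow> 'b::ring_1 \<Rightarrow> 'b) \<Rightarrow> ('a \<times> 'b \<Rightarrow>\<^sub>0 int) set ring" where
  "tensor_ring scA scB = pair_ring Quot (tensor_ideal scA scB)"

definition pure_tensor ::
  "('f::field \<Rightarrow> 'a::ring_1 \<Rightarrow> 'a) \<Rightarrow> ('f \<Rightarrow> 'b::ring_1 \<Rightarrow> 'b) \<Rightarrow> 'a \<Rightarrow> 'b \<Rightarrow> ('a \<times> 'b \<Rightarrow>\<^sub>0 int) set" where
  "pure_tensor scA scB a b = tensor_ideal scA scB +>\<^bsub>pair_ring\<^esub> frag_of (a, b)"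

lemma pair_mult_frag_of [simp]:
  "pair_mult (frag_of p) (frag_of q) = frag_of (fst p * fst q, snd p * snd q)"
  by (simp add: pair_mult_def)

lemma pair_mult_diff_left: "pair_mult (f - f') g = pair_mult f g - pair_mult f' g"
  by (simp add: pair_mult_def frag_extend_diff)

lemma pair_mult_add_left: "pair_mult (f + f') g = pair_mult f g + pair_mult f' g"
  by (simp add: pair_mult_def frag_extend_add)

lemma frag_extend_fun_diff:
  "frag_extend (\<lambda>p. h p - h' p) f = frag_extend h f - frag_extend h' f"
  by (induction f rule: frag_induction[OF subset_UNIV]) (auto simp: frag_extend_diff)

lemma pair_mult_diff_right: "pair_mult f (g - g') = pair_mult f g - pair_mult f g'"
  by (simp add: pair_mult_def frag_extend_diff frag_extend_fun_diff)

lemma pair_mult_zero [simp]: "pair_mult 0 g = 0" "pair_mult f 0 = 0"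
  using pair_mult_diff_left[of 0 0 g] pair_mult_diff_right[of f 0 0] by simp_all

lemma pair_mult_add_right: "pair_mult f (g + g') = pair_mult f g + pair_mult f g'"
  using pair_mult_diff_right[of f "g + g'" g'] by (simp add: algebra_simps)

lemma pair_mult_assoc: "pair_mult (pair_mult f g) h = pair_mult f (pair_mult g h)"
proof (induction f rule: frag_induction[OF subset_UNIV])
  case (2 p)
  show ?case
  proof (induction g rule: frag_induction[OF subset_UNIV])
    case (2 q)
    show ?case
      by (induction h rule: frag_induction[OF subset_UNIV])
        (auto simp: pair_mult_diff_right mult.assoc)
  qed (auto simp: pair_mult_diff_left pair_mult_diff_right)
qed (auto simp: pair_mult_diff_left)

lemma pair_mult_one: "pair_mult (frag_of (1, 1)) f = f" "pair_mult f (frag_of (1, 1)) = f"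
  by (induction f rule: frag_induction[OF subset_UNIV])
    (auto simp: pair_mult_diff_left pair_mult_diff_right)

lemma ring_pair_ring: "ring (pair_ring :: ('a::ring_1 \<times> 'b::ring_1 \<Rightarrow>\<^sub>0 int) ring)"
proof (rule ringI)
  show "abelian_group (pair_ring :: ('a \<times> 'b \<Rightarrow>\<^sub>0 int) ring)"
  proof (rule abelian_groupI)
    fix x :: "'a \<times> 'b \<Rightarrow>\<^sub>0 int"
    show "\<exists>y\<in>carrier pair_ring. y \<oplus>\<^bsub>pair_ring\<^esub> x = \<zero>\<^bsub>pair_ring\<^esub>"
      by (intro bexI[of _ "- x"]) (auto simp: pair_ring_def)
  qed (auto simp: pair_ring_def add_ac)
  show "Group.monoid (pair_ring :: ('a \<times> 'b \<Rightarrow>\<^sub>0 int) ring)"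
    by unfold_locales (auto simp: pair_ring_def pair_mult_assoc pair_mult_one)
qed (auto simp: pair_ring_def pair_mult_add_left pair_mult_add_right)

lemma ideal_tensor_ideal: "ideal (tensor_ideal scA scB) pair_ring"
  unfolding tensor_ideal_def
  by (rule ring.genideal_ideal[OF ring_pair_ring]) (auto simp: pair_ring_def)

lemma ring_tensor_ring: "ring (tensor_ring scA scB)"
  unfolding tensor_ring_def by (rule ideal.quotient_is_ring[OF ideal_tensor_ideal])

section \<open>Scalar extension and etale algebras\<close>

text \<open>The image of the separable closure in the scalar extension of an algebra; the scalar
  multiplication of the scalar extension is multiplication by these central elements.\<close>

definition ext_scalars ::
  "('f::field \<Rightarrow> 'a::ring_1 \<Rightarrow> 'a) \<Rightarrow> ('f \<Rightarrow> 's::field \<Rightarrow> 's) \<Rightarrow> ('a \<times> 's \<Rightarrow>\<^sub>0 int) set set" where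
  "ext_scalars scA scS = range (\<lambda>c. pure_tensor scA scS 1 c)"

definition power_ring :: "nat \<Rightarrow> (nat \<Rightarrow> 's::field) ring" where
  "power_ring n = \<lparr>carrier = {..<n} \<rightarrow>\<^sub>E UNIV,
     monoid.mult = (\<lambda>x y. \<lambda>i\<in>{..<n}. x i * y i), one = (\<lambda>i\<in>{..<n}. 1),
     ring.zero = (\<lambda>i\<in>{..<n}. 0), ring.add = (\<lambda>x y. \<lambda>i\<in>{..<n}. x i + y i)\<rparr>"

definition etale ::
  "('f::field \<Rightarrow> 's::field \<Rightarrow> 's) \<Rightarrow> ('f \<Rightarrow> 'l::comm_ring_1 \<Rightarrow> 'l) \<Rightarrow> nat \<Rightarrow> bool" where
  "etale scS scL n \<longleftrightarrow>
     assoc_algebra scL \<and>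
     (\<exists>\<phi> \<in> ring_iso (tensor_ring scL scS) (power_ring n :: (nat \<Rightarrow> 's) ring).
        \<forall>c. \<phi> (pure_tensor scL scS 1 c) = (\<lambda>i\<in>{..<n}. c))"

definition alg_points ::
  "('f::field \<Rightarrow> 's::field \<Rightarrow> 's) \<Rightarrow> ('f \<Rightarrow> 'l::comm_ring_1 \<Rightarrow> 'l) \<Rightarrow> ('l \<Rightarrow> 's) set" where
  "alg_points scS scL = {\<xi>. algebra_hom scL scS \<xi>}"

definition alg_points_action ::
  "('f::field \<Rightarrow> 's::field \<Rightarrow> 's) \<Rightarrow> ('f \<Rightarrow> 'l::comm_ring_1 \<Rightarrow> 'l) \<Rightarrow>
   ('s \<Rightarrow> 's) \<Rightarrow> ('l \<Rightarrow> 's) \<Rightarrow> ('l \<Rightarrow> 's)" where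
  "alg_points_action scS scL \<gamma> = (\<lambda>\<xi>\<in>alg_points scS scL. \<gamma> \<circ> \<xi>)"

section \<open>The Severi--Brauer space\<close>

definition right_ideal :: "'r set \<Rightarrow> 'r ring \<Rightarrow> bool" where
  "right_ideal I R \<longleftrightarrow>
     additive_subgroup I R \<and> (\<forall>x\<in>I. \<forall>r\<in>carrier R. x \<otimes>\<^bsub>R\<^esub> r \<in> I)"

text \<open>The linear varieties of (projective) dimension \<^term>\<open>k - 1\<close>.\<close>

definition SB_linear ::
  "('f::field \<Rightarrow> 'a::ring_1 \<Rightarrow> 'a) \<Rightarrow> ('f \<Rightarrow> 's::field \<Rightarrow> 's) \<Rightarrow> nat \<Rightarrow> nat \<Rightarrow>
   ('a \<times> 's \<Rightarrow>\<^sub>0 int) set set set" where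
  "SB_linear scA scS n k =
     {I. right_ideal I (tensor_ring scA scS) \<and>
         ring.dimension (tensor_ring scA scS) (n * k) (ext_scalars scA scS) I}"

abbreviation SB_points where "SB_points scA scS n \<equiv> SB_linear scA scS n 1"

text \<open>The map induced by \<open>a \<otimes> c \<mapsto> a \<otimes> \<gamma> c\<close>; an automorphism over the base field
  preserves the tensor relations, so it maps cosets onto cosets.\<close>

definition gal_tensor ::
  "('s \<Rightarrow> 's) \<Rightarrow> ('a \<times> 's \<Rightarrow>\<^sub>0 int) set \<Rightarrow> ('a \<times> 's \<Rightarrow>\<^sub>0 int) set" where
  "gal_tensor \<gamma> = image (frag_extend (\<lambda>(a, c). frag_of (a, \<gamma> c)))"

definition general_position ::
  "('f::field \<Rightarrow> 'a::ring_1 \<Rightarrow> 'a) \<Rightarrow> ('f \<Rightarrow> 's::field \<Rightarrow> 's) \<Rightarrow> nat \<Rightarrow>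
   ('a \<times> 's \<Rightarrow>\<^sub>0 int) set set set \<Rightarrow> bool" where
  "general_position scA scS n P \<longleftrightarrow>
     (\<forall>k\<in>{1..n}. \<forall>J\<in>SB_linear scA scS n k.
        (\<forall>I\<in>P. I \<subseteq> J) \<longrightarrow> J = carrier (tensor_ring scA scS))"

definition general_embedding ::
  "('f::field \<Rightarrow> 'a::ring_1 \<Rightarrow> 'a) \<Rightarrow> ('f \<Rightarrow> 's::field \<Rightarrow> 's) \<Rightarrow> nat \<Rightarrow> 'x set \<Rightarrow>
   (('s \<Rightarrow> 's) \<Rightarrow> 'x \<Rightarrow> 'x) \<Rightarrow> ('x \<Rightarrow> ('a \<times> 's \<Rightarrow>\<^sub>0 int) set set) \<Rightarrow> bool" where
  "general_embedding scA scS n S act f \<longleftrightarrow>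
     galois_set scS n S act \<and>
     f ` S \<subseteq> SB_points scA scS n \<and> inj_on f S \<and>
     (\<forall>\<gamma>\<in>carrier (galois_group scS). \<forall>x\<in>S. f (act \<gamma> x) = gal_tensor \<gamma> ` f x) \<and>
     card (f ` S) = n \<and> general_position scA scS n (f ` S)"

definition eigen_ideal ::
  "('f::field \<Rightarrow> 'a::ring_1 \<Rightarrow> 'a) \<Rightarrow> ('f \<Rightarrow> 's::field \<Rightarrow> 's) \<Rightarrow> ('l \<Rightarrow> 'a) \<Rightarrow> ('l \<Rightarrow> 's) \<Rightarrow>
   ('a \<times> 's \<Rightarrow>\<^sub>0 int) set set" where
  "eigen_ideal scA scS \<epsilon> \<xi> =
     {x \<in> carrier (tensor_ring scA scS). \<forall>l.
        pure_tensor scA scS 1 (\<xi> l) \<otimes>\<^bsub>tensor_ring scA scS\<^esub> x =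
        pure_tensor scA scS (\<epsilon> l) 1 \<otimes>\<^bsub>tensor_ring scA scS\<^esub> x}"

end

theory Submission
  imports Defs
begin

text \<open>The primitive idempotents of \<open>L\<^sub>s\<close>, which correspond to the points of \<open>L\<close>, map to nonzero
  orthogonal idempotents \<open>e\<^sub>1, \<dots>, e\<^sub>n\<close> of \<open>A\<^sub>s\<close> with sum 1, and the eigenspace of the \<open>i\<close>-th point
  is \<open>e\<^sub>i A\<^sub>s\<close>. Since \<open>A\<^sub>s\<close> is simple, all Peirce components \<open>e\<^sub>i A\<^sub>s e\<^sub>j\<close> are nonzero; there are
  \<open>n\<^sup>2\<close> of them in a space of dimension \<open>n\<^sup>2\<close>, so each is a line and \<open>e\<^sub>i A\<^sub>s\<close> has dimension \<open>n\<close>.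
  No splitting of \<open>A\<^sub>s\<close> is needed.\<close>

section \<open>Additive functions on tensor products\<close>

text \<open>\<open>L\<^sub>s\<close> and \<open>A\<^sub>s\<close> are given only as quotients of the
  free abelian group on pairs, so upper bounds are easy (relations hold by construction) while every
  nonvanishing statement, even \<open>1 \<noteq> 0\<close>, needs a map out of the quotient. Such
  maps come from balanced functions, whose additive extensions kill the tensor ideal. The ones used
  are coordinates along a basis of \<open>A\<close>, coordinates along a basis of
  \<open>F\<^sub>s\<close>, evaluations at points of \<open>L\<close>, and evaluations composed with
  a linear retraction of \<open>A\<close> onto \<open>L\<close>. Computations are done on
  representatives modulo the ideal, and only the dimension count takes place in the quotient ring.

  Simplicity of \<open>A\<^sub>s\<close> is used in the form of primeness: nonzero x and y admit z
  with x z y nonzero. A basis of \<open>F\<^sub>s\<close> over \<open>F\<close> may be infinite, but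
  each tensor involves finitely many basis elements, which suffices for an argument by minimal
  support.\<close>

text \<open>Values may lie in any ring, whereas those of \<open>frag_extend\<close> are again formal
  sums; this is what makes functionals on tensors available.\<close>

definition pair_extend :: "('p \<Rightarrow> 'c::ring_1) \<Rightarrow> ('p \<Rightarrow>\<^sub>0 int) \<Rightarrow> 'c" where
  "pair_extend \<beta> f = (\<Sum>p\<in>Poly_Mapping.keys f. of_int (Poly_Mapping.lookup f p) * \<beta> p)"

lemma pair_extend_superset:
  assumes "finite K" "Poly_Mapping.keys f \<subseteq> K"
  shows "pair_extend \<beta> f = (\<Sum>p\<in>K. of_int (Poly_Mapping.lookup f p) * \<beta> p)"
  unfolding pair_extend_def
  by (rule sum.mono_neutral_left) (use assms in \<open>auto simp: in_keys_iff\<close>)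

lemma pair_extend_zero [simp]: "pair_extend \<beta> 0 = 0"
  by (simp add: pair_extend_def)

lemma pair_extend_of [simp]: "pair_extend \<beta> (frag_of p) = \<beta> p"
  by (simp add: pair_extend_def)

lemma pair_extend_diff: "pair_extend \<beta> (f - g) = pair_extend \<beta> f - pair_extend \<beta> g"
proof -
  let ?K = "Poly_Mapping.keys f \<union> Poly_Mapping.keys g"
  have "pair_extend \<beta> h = (\<Sum>p\<in>?K. of_int (Poly_Mapping.lookup h p) * \<beta> p)"
    if "h \<in> {f, g, f - g}" for h
    by (rule pair_extend_superset) (use that keys_diff[of f g] in auto)
  then show ?thesis
    by (simp add: lookup_minus algebra_simps sum_subtractf)
qed

lemma pair_extend_minus: "pair_extend \<beta> (- f) = - pair_extend \<beta> f"
  using pair_extend_diff[of \<beta> 0 f] by simp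

lemma pair_extend_add: "pair_extend \<beta> (f + g) = pair_extend \<beta> f + pair_extend \<beta> g"
  using pair_extend_diff[of \<beta> f "- g"] by (simp add: pair_extend_minus)

lemma pair_extend_sum: "pair_extend \<beta> (sum f K) = (\<Sum>k\<in>K. pair_extend \<beta> (f k))"
  by (induction K rule: infinite_finite_induct) (simp_all add: pair_extend_add)

lemma frag_induct [case_names zero one diff]:
  assumes "P 0" "\<And>a b. P (frag_of (a, b))" "\<And>f g. P f \<Longrightarrow> P g \<Longrightarrow> P (f - g)"
  shows "P f"
  by (rule frag_induction[of f UNIV]) (use assms in auto)

definition balanced ::
  "('f::field \<Rightarrow> 'a::ring_1 \<Rightarrow> 'a) \<Rightarrow> ('f \<Rightarrow> 'b::ring_1 \<Rightarrow> 'b) \<Rightarrow> ('a \<times> 'b \<Rightarrow> 'c::ring_1) \<Rightarrow> bool" where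
  "balanced scA scB \<beta> \<longleftrightarrow>
     (\<forall>a a' b. \<beta> (a + a', b) = \<beta> (a, b) + \<beta> (a', b)) \<and>
     (\<forall>a b b'. \<beta> (a, b + b') = \<beta> (a, b) + \<beta> (a, b')) \<and>
     (\<forall>r a b. \<beta> (scA r a, b) = \<beta> (a, scB r b))"

section \<open>Homomorphisms and the maps they induce on tensors\<close>

lemma algebra_homD:
  assumes "algebra_hom scA scB h"
  shows "h (x + y) = h x + h y" "h (x - y) = h x - h y" "h 0 = 0" "h (- x) = - h x"
    and "h (scA r x) = scB r (h x)" "h 1 = 1" "h (x * y) = h x * h y"
proof -
  interpret Vector_Spaces.linear scA scB h
    using assms by (simp add: algebra_hom_def)
  show "h (x + y) = h x + h y" "h (x - y) = h x - h y" "h 0 = 0" "h (- x) = - h x"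
    "h (scA r x) = scB r (h x)"
    by (rule add diff zero neg scale)+
  show "h 1 = 1" "h (x * y) = h x * h y"
    using assms by (auto simp: algebra_hom_def)
qed

text \<open>Acts on representatives. Two instances matter: \<open>tensor_map \<epsilon> id\<close>
  is the map from \<open>L\<^sub>s\<close> to \<open>A\<^sub>s\<close>, and
  \<open>tensor_map id \<gamma>\<close> is the Galois action underlying
  \<open>gal_tensor\<close>.\<close>

definition tensor_map :: "('a \<Rightarrow> 'c) \<Rightarrow> ('b \<Rightarrow> 'd) \<Rightarrow> ('a \<times> 'b \<Rightarrow>\<^sub>0 int) \<Rightarrow> ('c \<times> 'd \<Rightarrow>\<^sub>0 int)" where
  "tensor_map g h = frag_extend (\<lambda>(a, b). frag_of (g a, h b))"

lemma tensor_map_of [simp]: "tensor_map g h (frag_of (a, b)) = frag_of (g a, h b)"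
  by (simp add: tensor_map_def)

lemma tensor_map_zero [simp]: "tensor_map g h 0 = 0"
  by (simp add: tensor_map_def)

lemma tensor_map_diff: "tensor_map g h (x - y) = tensor_map g h x - tensor_map g h y"
  by (simp add: tensor_map_def frag_extend_diff)

lemma tensor_map_add: "tensor_map g h (x + y) = tensor_map g h x + tensor_map g h y"
  by (simp add: tensor_map_def frag_extend_add)

lemma tensor_map_mult:
  assumes "\<And>x y. g (x * y) = g x * g y" "\<And>x y. h (x * y) = h x * h y"
  shows "tensor_map g h (pair_mult x y) = pair_mult (tensor_map g h x) (tensor_map g h y)"
proof (induction x rule: frag_induct)
  case (one a b)
  show ?case
    by (induction y rule: frag_induct)
      (simp_all add: pair_mult_diff_right tensor_map_diff assms)
qed (simp_all add: pair_mult_diff_left tensor_map_diff)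

lemma tensor_map_tensor_map: "tensor_map g h (tensor_map g' h' x) = tensor_map (g \<circ> g') (h \<circ> h') x"
  by (induction x rule: frag_induct) (simp_all add: tensor_map_diff)

lemma tensor_map_id [simp]: "tensor_map id id x = x"
  by (induction x rule: frag_induct) (simp_all add: tensor_map_diff)

lemma pair_extend_tensor_map:
  "pair_extend \<beta> (tensor_map g h x) = pair_extend (\<lambda>(a, b). \<beta> (g a, h b)) x"
  by (induction x rule: frag_induct) (simp_all add: tensor_map_diff pair_extend_diff)

text \<open>Products are biadditive and pairs generate the group, so absorption need only be tested
  against single pairs.\<close>

lemma ideal_pair_ringI:
  fixes N :: "('a::ring_1 \<times> 'b::ring_1 \<Rightarrow>\<^sub>0 int) set"
  assumes zeroN: "0 \<in> N" and diffN: "\<And>x y. x \<in> N \<Longrightarrow> y \<in> N \<Longrightarrow> x - y \<in> N"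
    and left: "\<And>x a b. x \<in> N \<Longrightarrow> pair_mult (frag_of (a, b)) x \<in> N"
    and right: "\<And>x a b. x \<in> N \<Longrightarrow> pair_mult x (frag_of (a, b)) \<in> N"
  shows "ideal N pair_ring"
proof (rule idealI[OF ring_pair_ring])
  interpret ring "pair_ring :: ('a \<times> 'b \<Rightarrow>\<^sub>0 int) ring"
    by (rule ring_pair_ring)
  have uminus: "- x \<in> N" if "x \<in> N" for x
    using diffN[OF zeroN that] by simp
  have "x + y \<in> N" if "x \<in> N" "y \<in> N" for x y
    using diffN[OF that(1) uminus[OF that(2)]] by simp
  moreover have "\<ominus>\<^bsub>pair_ring\<^esub> x = - x" for x :: "'a \<times> 'b \<Rightarrow>\<^sub>0 int"
    by (rule minus_equality) (auto simp: pair_ring_def)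
  ultimately show "subgroup N (add_monoid pair_ring)"
    using uminus zeroN by (intro add.subgroupI) (auto simp: pair_ring_def a_inv_def)
next
  fix x y :: "'a \<times> 'b \<Rightarrow>\<^sub>0 int" assume "x \<in> N"
  show "y \<otimes>\<^bsub>pair_ring\<^esub> x \<in> N"
    by (induction y rule: frag_induct)
      (use \<open>x \<in> N\<close> in \<open>simp_all add: pair_ring_def zeroN diffN left pair_mult_diff_left\<close>)
  show "x \<otimes>\<^bsub>pair_ring\<^esub> y \<in> N"
    by (induction y rule: frag_induct)
      (use \<open>x \<in> N\<close> in \<open>simp_all add: pair_ring_def zeroN diffN right pair_mult_diff_right\<close>)
qed

section \<open>Congruences modulo the tensor relations\<close>

lemma tensor_ideal_minimal:
  "ideal N pair_ring \<Longrightarrow> tensor_relations scA scB \<subseteq> N \<Longrightarrow> tensor_ideal scA scB \<subseteq> N"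
  unfolding tensor_ideal_def by (rule ring.genideal_minimal[OF ring_pair_ring])

lemma tensor_relations_subset_ideal: "tensor_relations scA scB \<subseteq> tensor_ideal scA scB"
  unfolding tensor_ideal_def
  by (rule ring.genideal_self[OF ring_pair_ring]) (simp add: pair_ring_def)

lemma
  fixes scA :: "'f::field \<Rightarrow> 'a::ring_1 \<Rightarrow> 'a" and scB :: "'f \<Rightarrow> 'b::ring_1 \<Rightarrow> 'b"
  shows zero_ideal: "0 \<in> tensor_ideal scA scB"
    and add_ideal: "x \<in> tensor_ideal scA scB \<Longrightarrow> y \<in> tensor_ideal scA scB \<Longrightarrow> x + y \<in> tensor_ideal scA scB"
    and minus_ideal: "x \<in> tensor_ideal scA scB \<Longrightarrow> - x \<in> tensor_ideal scA scB"
    and diff_ideal: "x \<in> tensor_ideal scA scB \<Longrightarrow> y \<in> tensor_ideal scA scB \<Longrightarrow> x - y \<in> tensor_ideal scA scB"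
    and mult_left_ideal: "x \<in> tensor_ideal scA scB \<Longrightarrow> pair_mult z x \<in> tensor_ideal scA scB"
    and mult_right_ideal: "x \<in> tensor_ideal scA scB \<Longrightarrow> pair_mult x z \<in> tensor_ideal scA scB"
proof -
  let ?I = "tensor_ideal scA scB"
  interpret I: ideal ?I pair_ring
    by (rule ideal_tensor_ideal)
  have uminus: "- x \<in> ?I" if "x \<in> ?I" for x
  proof -
    have "\<ominus>\<^bsub>pair_ring\<^esub> x = - x"
      by (rule I.minus_equality) (auto simp: pair_ring_def)
    then show ?thesis
      using additive_subgroup.a_inv_closed[OF I.is_additive_subgroup that] by simp
  qed
  have add: "x + y \<in> ?I" if "x \<in> ?I" "y \<in> ?I" for x y
    using additive_subgroup.a_closed[OF I.is_additive_subgroup that] by (simp add: pair_ring_def)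
  show "0 \<in> ?I"
    using additive_subgroup.zero_closed[OF I.is_additive_subgroup] by (simp add: pair_ring_def)
  show "x \<in> ?I \<Longrightarrow> y \<in> ?I \<Longrightarrow> x + y \<in> ?I" "x \<in> ?I \<Longrightarrow> - x \<in> ?I"
    by (fact add uminus)+
  show "x \<in> ?I \<Longrightarrow> y \<in> ?I \<Longrightarrow> x - y \<in> ?I"
    using add[OF _ uminus, of x y] by simp
  show "x \<in> ?I \<Longrightarrow> pair_mult z x \<in> ?I" "x \<in> ?I \<Longrightarrow> pair_mult x z \<in> ?I"
    using I.I_l_closed[of x z] I.I_r_closed[of x z] by (simp_all add: pair_ring_def)
qed

lemma frag_add_left: "frag_of (a + a', b) - frag_of (a, b) - frag_of (a', b) \<in> tensor_ideal scA scB"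
  using tensor_relations_subset_ideal[of scA scB] unfolding tensor_relations_def by blast

lemma frag_add_right: "frag_of (a, b + b') - frag_of (a, b) - frag_of (a, b') \<in> tensor_ideal scA scB"
  using tensor_relations_subset_ideal[of scA scB] unfolding tensor_relations_def by blast

lemma frag_scale: "frag_of (scA r a, b) - frag_of (a, scB r b) \<in> tensor_ideal scA scB"
  using tensor_relations_subset_ideal[of scA scB] unfolding tensor_relations_def by blast

locale algebra_pair = A: assoc_algebra scA + B: assoc_algebra scB
  for scA :: "'f::field \<Rightarrow> 'a::ring_1 \<Rightarrow> 'a" and scB :: "'f \<Rightarrow> 'b::ring_1 \<Rightarrow> 'b"
begin

abbreviation "I \<equiv> tensor_ideal scA scB"

lemma ideal_trans: "x - y \<in> I \<Longrightarrow> y - z \<in> I \<Longrightarrow> x - z \<in> I"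
  using add_ideal[where x = "x - y" and y = "y - z"] by simp

lemma ideal_sym: "x - y \<in> I \<Longrightarrow> y - x \<in> I"
  using minus_ideal[where x = "x - y"] by simp

lemma sum_ideal: "(\<And>k. k \<in> K \<Longrightarrow> x k \<in> I) \<Longrightarrow> sum x K \<in> I"
  by (induction K rule: infinite_finite_induct) (auto simp: zero_ideal add_ideal)

lemma frag_zero_left: "frag_of (0, b) \<in> I"
  using minus_ideal[OF frag_add_left[of 0 0 b]] by simp

lemma frag_zero_right: "frag_of (a, 0) \<in> I"
  using minus_ideal[OF frag_add_right[of a 0 0]] by simp

lemma frag_sum_left: "frag_of (sum a K, b) - (\<Sum>k\<in>K. frag_of (a k, b)) \<in> I"
proof (induction K rule: infinite_finite_induct)
  case (insert k K)
  then show ?case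
    using add_ideal[OF frag_add_left[of "a k" "sum a K" b]] by (fastforce simp: algebra_simps)
qed (simp_all add: frag_zero_left)

lemma frag_sum_right: "frag_of (a, sum b K) - (\<Sum>k\<in>K. frag_of (a, b k)) \<in> I"
proof (induction K rule: infinite_finite_induct)
  case (insert k K)
  then show ?case
    using add_ideal[OF frag_add_right[of a "b k" "sum b K"]] by (fastforce simp: algebra_simps)
qed (simp_all add: frag_zero_right)

text \<open>Additivity applied to \<open>a - a'\<close> and \<open>a'\<close>; this form fits the
  difference step of \<open>frag_induct\<close>.\<close>

lemma frag_diff_left: "frag_of (a - a', b) - (frag_of (a, b) - frag_of (a', b)) \<in> I"
  using minus_ideal[OF frag_add_left[of "a - a'" a' b]] by (simp add: algebra_simps)

lemma frag_diff_right: "frag_of (a, b - b') - (frag_of (a, b) - frag_of (a, b')) \<in> I"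
  using minus_ideal[OF frag_add_right[of a "b - b'" b']] by (simp add: algebra_simps)

text \<open>The elements killed by all balanced functions form an ideal, since balanced functions
  are stable under precomposition with multiplications.\<close>

lemma pair_extend_ideal:
  fixes \<beta> :: "'a \<times> 'b \<Rightarrow> 'c::ring_1"
  assumes "x \<in> I" "balanced scA scB \<beta>"
  shows "pair_extend \<beta> x = 0"
proof -
  define N where "N = {x. \<forall>\<beta> :: 'a \<times> 'b \<Rightarrow> 'c. balanced scA scB \<beta> \<longrightarrow> pair_extend \<beta> x = 0}"
  have "ideal N pair_ring"
  proof (rule ideal_pair_ringI)
    fix x a b assume x: "x \<in> N"
    have "pair_extend \<beta> (pair_mult (frag_of (a, b)) x) = pair_extend (\<lambda>(a', b'). \<beta> (a * a', b * b')) x"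
      for \<beta> :: "'a \<times> 'b \<Rightarrow> 'c"
      by (induction x rule: frag_induct) (simp_all add: pair_mult_diff_right pair_extend_diff)
    moreover have "balanced scA scB (\<lambda>(a', b'). \<beta> (a * a', b * b'))" if "balanced scA scB \<beta>"
      for \<beta> :: "'a \<times> 'b \<Rightarrow> 'c"
      using that by (simp add: balanced_def distrib_left A.scale_mult_right B.scale_mult_right)
    ultimately show "pair_mult (frag_of (a, b)) x \<in> N"
      using x by (auto simp: N_def)
    have "pair_extend \<beta> (pair_mult x (frag_of (a, b))) = pair_extend (\<lambda>(a', b'). \<beta> (a' * a, b' * b)) x"
      for \<beta> :: "'a \<times> 'b \<Rightarrow> 'c"
      by (induction x rule: frag_induct) (simp_all add: pair_mult_diff_left pair_extend_diff)
    moreover have "balanced scA scB (\<lambda>(a', b'). \<beta> (a' * a, b' * b))" if "balanced scA scB \<beta>"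
      for \<beta> :: "'a \<times> 'b \<Rightarrow> 'c"
      using that by (simp add: balanced_def distrib_right A.scale_mult_left B.scale_mult_left)
    ultimately show "pair_mult x (frag_of (a, b)) \<in> N"
      using x by (auto simp: N_def)
  qed (auto simp: N_def pair_extend_diff)
  moreover have "tensor_relations scA scB \<subseteq> N"
    by (auto simp: tensor_relations_def N_def pair_extend_diff balanced_def)
  ultimately show ?thesis
    using tensor_ideal_minimal assms unfolding N_def by blast
qed

text \<open>Multiplicativity of \<open>g\<close> and \<open>h\<close> makes the preimage of the
  target ideal an ideal; it contains the relations, hence all that they generate.\<close>

lemma tensor_map_ideal:
  assumes "algebra_hom scA scC g" "algebra_hom scB scD h" "x \<in> I"
  shows "tensor_map g h x \<in> tensor_ideal scC scD"
proof -
  note gh = algebra_homD[OF assms(1)] algebra_homD[OF assms(2)]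
  let ?J = "tensor_ideal scC scD"
  have "ideal {x. tensor_map g h x \<in> ?J} pair_ring"
    by (rule ideal_pair_ringI)
      (auto simp: tensor_map_mult gh tensor_map_diff zero_ideal diff_ideal mult_left_ideal mult_right_ideal)
  moreover have "tensor_relations scA scB \<subseteq> {x. tensor_map g h x \<in> ?J}"
    by (auto simp: tensor_relations_def tensor_map_diff gh frag_add_left frag_add_right frag_scale)
  ultimately show ?thesis
    using tensor_ideal_minimal assms(3) by blast
qed

end


section \<open>Residue classes of tensors\<close>

text \<open>Extends \<open>pure_tensor\<close> from pairs to formal sums, so that every element of
  the tensor ring has this form.\<close>

definition tensor_class ::
  "('f::field \<Rightarrow> 'a::ring_1 \<Rightarrow> 'a) \<Rightarrow> ('f \<Rightarrow> 'b::ring_1 \<Rightarrow> 'b) \<Rightarrow>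
   ('a \<times> 'b \<Rightarrow>\<^sub>0 int) \<Rightarrow> ('a \<times> 'b \<Rightarrow>\<^sub>0 int) set" where
  "tensor_class scA scB x = tensor_ideal scA scB +>\<^bsub>pair_ring\<^esub> x"

lemma pure_tensor_eq_class: "pure_tensor scA scB a b = tensor_class scA scB (frag_of (a, b))"
  by (simp add: pure_tensor_def tensor_class_def)

lemma mem_tensor_class: "y \<in> tensor_class scA scB x \<longleftrightarrow> y - x \<in> tensor_ideal scA scB"
proof -
  have "y \<in> tensor_class scA scB x \<longleftrightarrow> (\<exists>h\<in>tensor_ideal scA scB. y = h + x)"
    by (simp add: tensor_class_def a_r_coset_def' pair_ring_def)
  also have "\<dots> \<longleftrightarrow> y - x \<in> tensor_ideal scA scB"
    by (auto intro!: bexI[of _ "y - x"])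
  finally show ?thesis .
qed

lemma tensor_class_eq_iff:
  "tensor_class scA scB x = tensor_class scA scB y \<longleftrightarrow> x - y \<in> tensor_ideal scA scB"
proof
  assume "tensor_class scA scB x = tensor_class scA scB y"
  moreover have "x \<in> tensor_class scA scB x"
    by (simp add: mem_tensor_class zero_ideal)
  ultimately show "x - y \<in> tensor_ideal scA scB"
    by (simp add: mem_tensor_class)
next
  assume xy: "x - y \<in> tensor_ideal scA scB"
  then have "z - x \<in> tensor_ideal scA scB \<longleftrightarrow> z - y \<in> tensor_ideal scA scB" for z
    using add_ideal[where x = "z - x" and y = "x - y"] diff_ideal[where x = "z - y" and y = "x - y"]
    by fastforce
  then show "tensor_class scA scB x = tensor_class scA scB y"
    by (auto simp: mem_tensor_class)
qed

lemma carrier_pair_ring: "carrier pair_ring = UNIV"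
  by (simp add: pair_ring_def)

lemma carrier_tensor_ring: "carrier (tensor_ring scA scB) = range (tensor_class scA scB)"
  unfolding tensor_ring_def FactRing_simps by (auto simp: tensor_class_def carrier_pair_ring)

lemma tensor_class_closed [simp]: "tensor_class scA scB x \<in> carrier (tensor_ring scA scB)"
  by (simp add: carrier_tensor_ring)

lemma tensor_class_add:
  "tensor_class scA scB x \<oplus>\<^bsub>tensor_ring scA scB\<^esub> tensor_class scA scB y = tensor_class scA scB (x + y)"
  using ideal.a_rcos_sum[OF ideal_tensor_ideal, of x y scA scB]
  by (simp add: tensor_ring_def FactRing_def tensor_class_def pair_ring_def)

lemma tensor_class_mult:
  "tensor_class scA scB x \<otimes>\<^bsub>tensor_ring scA scB\<^esub> tensor_class scA scB y =
     tensor_class scA scB (pair_mult x y)"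
  using ideal.rcoset_mult_add[OF ideal_tensor_ideal, of x y scA scB]
  by (simp add: tensor_ring_def FactRing_def tensor_class_def pair_ring_def)

lemma tensor_ring_one: "\<one>\<^bsub>tensor_ring scA scB\<^esub> = tensor_class scA scB (frag_of (1, 1))"
  by (simp add: tensor_ring_def FactRing_def tensor_class_def pair_ring_def)

lemma tensor_ring_zero: "\<zero>\<^bsub>tensor_ring scA scB\<^esub> = tensor_class scA scB 0"
proof -
  have "tensor_class scA scB 0 = tensor_ideal scA scB"
    by (auto simp: mem_tensor_class)
  then show ?thesis
    by (simp add: tensor_ring_def FactRing_def)
qed

lemma tensor_class_minus:
  "\<ominus>\<^bsub>tensor_ring scA scB\<^esub> tensor_class scA scB x = tensor_class scA scB (- x)"
  by (rule abelian_group.minus_equality[OF ring.is_abelian_group[OF ring_tensor_ring]])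
    (simp_all add: tensor_class_add tensor_ring_zero)

lemmas tensor_class_simps = tensor_class_add tensor_class_mult tensor_class_minus
  tensor_ring_zero tensor_ring_one

lemma subgroup_tensor_class:
  assumes "0 \<in> N" "\<And>x y. x \<in> N \<Longrightarrow> y \<in> N \<Longrightarrow> x - y \<in> N"
  shows "subgroup (tensor_class scA scB ` N) (add_monoid (tensor_ring scA scB))"
proof -
  interpret ring "tensor_ring scA scB"
    by (rule ring_tensor_ring)
  have m: "- x \<in> N" if "x \<in> N" for x
    using assms(2)[OF assms(1) that] by simp
  have p: "x + y \<in> N" if "x \<in> N" "y \<in> N" for x y
    using assms(2)[OF that(1) m[OF that(2)]] by simp
  show ?thesis
    by (rule add.subgroupI)
      (use assms(1) m p in \<open>auto simp: tensor_class_simps simp flip: a_inv_def\<close>)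
qed

section \<open>Linear independence in rings\<close>

text \<open>A vector outside a subspace that contains the other vectors is not in their span. The
  subspaces \<open>W x\<close> will be kernels of projections or coordinates. In HOL-Algebra,
  \<open>subalgebra K V R\<close> means that \<open>V\<close> is a
  \<open>K\<close>-subspace.\<close>

lemma (in ring) independent_mapI:
  assumes K: "subfield K R" and "distinct xs" "u ` set xs \<subseteq> carrier R"
    and W: "\<And>x. x \<in> set xs \<Longrightarrow> subalgebra K (W x) R" "\<And>x. x \<in> set xs \<Longrightarrow> u x \<notin> W x"
      "\<And>x y. x \<in> set xs \<Longrightarrow> y \<in> set xs \<Longrightarrow> x \<noteq> y \<Longrightarrow> u y \<in> W x"
  shows "independent K (map u xs)"
  using assms(2-)
proof (induction xs)
  case (Cons x xs)
  have "Span K (map u xs) \<subseteq> W x"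
    by (rule subalgebra_Span_incl[OF K]) (use Cons.prems in auto)
  moreover have "independent K (map u xs)"
    by (rule Cons.IH) (use Cons.prems in auto)
  ultimately show ?case
    using Cons.prems by (auto intro!: li_Cons)
qed simp

lemma (in ring) subalgebraI:
  assumes "W \<subseteq> carrier R" "\<zero> \<in> W" "\<And>x. x \<in> W \<Longrightarrow> \<ominus> x \<in> W"
    "\<And>x y. x \<in> W \<Longrightarrow> y \<in> W \<Longrightarrow> x \<oplus> y \<in> W" "\<And>k x. k \<in> K \<Longrightarrow> x \<in> W \<Longrightarrow> k \<otimes> x \<in> W"
  shows "subalgebra K W R"
proof -
  have "subgroup W (add_monoid R)"
    by (rule add.subgroupI) (use assms in \<open>auto simp flip: a_inv_def\<close>)
  then show ?thesis
    by (simp add: subalgebra_def subalgebra_axioms_def assms(5))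
qed

text \<open>The \<open>n\<^sup>2\<close> Peirce components \<open>e i R e j\<close> are nonzero and independent in a space of
  dimension \<open>n\<^sup>2\<close>, so each is a line.\<close>

lemma (in ring) dimension_idempotent_ideal:
  fixes e :: "nat \<Rightarrow> 'a"
  assumes K: "subfield K R" and central: "\<And>k x. k \<in> K \<Longrightarrow> x \<in> carrier R \<Longrightarrow> k \<otimes> x = x \<otimes> k"
    and dim: "dimension (n\<^sup>2) K (carrier R)"
    and e: "\<And>i. i < n \<Longrightarrow> e i \<in> carrier R"
    and idem: "\<And>i. i < n \<Longrightarrow> e i \<otimes> e i = e i"
    and orth: "\<And>i j. i < n \<Longrightarrow> j < n \<Longrightarrow> i \<noteq> j \<Longrightarrow> e i \<otimes> e j = \<zero>"
    and nonzero: "\<And>i j. i < n \<Longrightarrow> j < n \<Longrightarrow> \<exists>z\<in>carrier R. e i \<otimes> z \<otimes> e j \<noteq> \<zero>"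
    and i: "i < n"
  shows "dimension n K ((\<otimes>) (e i) ` carrier R)"
proof -
  obtain z where z: "\<And>i j. i < n \<Longrightarrow> j < n \<Longrightarrow> z i j \<in> carrier R"
    "\<And>i j. i < n \<Longrightarrow> j < n \<Longrightarrow> e i \<otimes> z i j \<otimes> e j \<noteq> \<zero>"
    using nonzero by metis
  \<comment> \<open>One witness from each Peirce component; \<open>e k\<close> selects row
    \<open>k\<close> from the left (\<open>eu\<close>) and column \<open>k\<close> from the right
    (\<open>ue\<close>).\<close>
  define u where "u i j = e i \<otimes> z i j \<otimes> e j" for i j
  have KR: "K \<subseteq> carrier R"
    using subfieldE(3)[OF K] .
  have comm: "e i \<otimes> (k \<otimes> x) = k \<otimes> (e i \<otimes> x)" if "i < n" "k \<in> K" "x \<in> carrier R" for i k x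
  proof -
    have "k \<in> carrier R"
      using KR that(2) by blast
    then show ?thesis
      using that(3) e[OF that(1)] central[OF that(2) e[OF that(1)]] by (simp add: m_assoc[symmetric])
  qed
  have eu: "e k \<otimes> u i j = (if k = i then u i j else \<zero>)" if "k < n" "i < n" "j < n" for i j k
    using that e z(1) idem orth by (simp add: u_def m_assoc[symmetric])
  have ue: "u i j \<otimes> e k = (if k = j then u i j else \<zero>)" if "k < n" "i < n" "j < n" for i j k
    using that e z(1) idem orth by (simp add: u_def m_assoc)
  have uc: "u i j \<in> carrier R" if "i < n" "j < n" for i j
    using that e z(1) by (simp add: u_def)
  have u0: "u i j \<noteq> \<zero>" if "i < n" "j < n" for i j
    using that z(2) by (simp add: u_def)
  \<comment> \<open>Kernel of the projection to one Peirce component: it contains every witness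
    except the one from that component.\<close>
  define W where "W p = {x \<in> carrier R. e (fst p) \<otimes> x \<otimes> e (snd p) = \<zero>}" for p
  have W: "subalgebra K (W p) R" if "fst p < n" "snd p < n" for p
  proof (rule subalgebraI)
    fix x y k assume x: "x \<in> W p"
    then show "\<ominus> x \<in> W p"
      using that e by (simp add: W_def r_minus l_minus)
    show "x \<oplus> y \<in> W p" if "y \<in> W p"
      using x that \<open>fst p < n\<close> \<open>snd p < n\<close> e by (simp add: W_def r_distr l_distr)
    assume k: "k \<in> K"
    then have "k \<in> carrier R"
      using KR by blast
    then show "k \<otimes> x \<in> W p"
      using x that e k comm by (simp add: W_def m_assoc)
  qed (use that e in \<open>auto simp: W_def\<close>)
  have uW: "u i' j' \<in> W (i, j) \<longleftrightarrow> (i', j') \<noteq> (i, j)" if "i < n" "j < n" "i' < n" "j' < n" for i j i' j'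
  proof -
    have "e i \<otimes> u i' j' \<otimes> e j = (if i = i' \<and> j = j' then u i' j' else \<zero>)"
      using eu[OF that(1,3,4)] ue[OF that(2,3,4)] e[OF that(2)] by (cases "i = i'"; cases "j = j'") simp_all
    then show ?thesis
      using uc[OF that(3,4)] u0[OF that(3,4)] by (auto simp: W_def)
  qed
  have ind: "independent K (map (case_prod u) ps)" if "distinct ps" "set ps \<subseteq> {..<n} \<times> {..<n}" for ps
  proof (rule independent_mapI[OF K that(1), where W = W])
    show "case_prod u ` set ps \<subseteq> carrier R"
      using that(2) uc by auto
    fix p assume "p \<in> set ps"
    then have p: "fst p < n" "snd p < n"
      using that(2) by auto
    then show "subalgebra K (W p) R"
      by (rule W)
    show "case_prod u p \<notin> W p"
      using uW[OF p p] by (simp add: case_prod_beta)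
    fix q assume "q \<in> set ps" "p \<noteq> q"
    then have "fst q < n" "snd q < n"
      using that(2) by auto
    then show "case_prod u q \<in> W p"
      using uW[OF p, of "fst q" "snd q"] \<open>p \<noteq> q\<close> by (simp add: case_prod_beta)
  qed
  let ?ps = "List.product [0..<n] [0..<n]"
  have span: "Span K (map (case_prod u) ?ps) = carrier R"
  proof (rule iffD1[OF independent_length_eq_dimension[OF K dim ind]])
    show "set (map (case_prod u) ?ps) \<subseteq> carrier R"
      using uc by auto
  qed (auto simp: distinct_product power2_eq_square)
  \<comment> \<open>Row \<open>i\<close> of the witnesses. Its length \<open>n\<close> is the
    dimension sought, so it remains to identify its span \<open>E\<close> with
    \<open>e i R\<close>.\<close>
  define Us where "Us = map (case_prod u) (map (Pair i) [0..<n])"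
  have Usc: "set Us \<subseteq> carrier R"
    using uc i by (auto simp: Us_def)
  have Us: "independent K Us"
    unfolding Us_def by (rule ind) (use i in \<open>auto simp: distinct_map inj_on_def\<close>)
  define E where "E = Span K Us"
  note SU = Span_subgroup_props[OF K Usc, folded E_def] Span_smult_closed[OF K Usc, folded E_def]
    Span_base_incl[OF K Usc, folded E_def]
  \<comment> \<open>Instead of expanding in the basis: the elements that \<open>e i\<close> sends
    into \<open>E\<close> form a subspace containing all witnesses, hence everything.\<close>
  have "subalgebra K {x \<in> carrier R. e i \<otimes> x \<in> E} R"
  proof (rule subalgebraI)
    fix x y k assume x: "x \<in> {x \<in> carrier R. e i \<otimes> x \<in> E}"
    then show "\<ominus> x \<in> {x \<in> carrier R. e i \<otimes> x \<in> E}"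
      using e[OF i] SU by (simp add: r_minus)
    show "x \<oplus> y \<in> {x \<in> carrier R. e i \<otimes> x \<in> E}"
      if "y \<in> {x \<in> carrier R. e i \<otimes> x \<in> E}"
      using x that e[OF i] SU by (simp add: r_distr)
    assume k: "k \<in> K"
    then have "k \<in> carrier R"
      using KR by blast
    then show "k \<otimes> x \<in> {x \<in> carrier R. e i \<otimes> x \<in> E}"
      using x SU k comm[OF i] by simp
  qed (use SU e[OF i] in auto)
  moreover have "set (map (case_prod u) ?ps) \<subseteq> {x \<in> carrier R. e i \<otimes> x \<in> E}"
  proof -
    have "e i \<otimes> u k l \<in> E" if "k < n" "l < n" for k l
      using eu[OF i that] SU(2) SU(6) that by (auto simp: Us_def)
    then show ?thesis
      using uc by auto
  qed
  ultimately have "carrier R \<subseteq> {x \<in> carrier R. e i \<otimes> x \<in> E}"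
    using subalgebra_Span_incl[OF K] span by metis
  then have "(\<otimes>) (e i) ` carrier R \<subseteq> E"
    by auto
  moreover have "v \<in> (\<otimes>) (e i) ` carrier R" if v: "v \<in> E" for v
  proof -
    \<comment> \<open>Conversely \<open>e i\<close> fixes row \<open>i\<close>, hence its span, and
      a fixed \<open>v\<close> equals \<open>e i \<otimes> v\<close>.\<close>
    have "subalgebra K {x \<in> carrier R. e i \<otimes> x = x} R"
    proof (rule subalgebraI)
      fix x y k assume x: "x \<in> {x \<in> carrier R. e i \<otimes> x = x}"
      then show "\<ominus> x \<in> {x \<in> carrier R. e i \<otimes> x = x}"
        using e[OF i] by (simp add: r_minus)
      show "x \<oplus> y \<in> {x \<in> carrier R. e i \<otimes> x = x}" if "y \<in> {x \<in> carrier R. e i \<otimes> x = x}"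
        using x that e[OF i] by (simp add: r_distr)
      assume k: "k \<in> K"
      then have "k \<in> carrier R"
        using KR by blast
      then show "k \<otimes> x \<in> {x \<in> carrier R. e i \<otimes> x = x}"
        using x k comm[OF i] by simp
    qed (use e[OF i] in auto)
    moreover have "set Us \<subseteq> {x \<in> carrier R. e i \<otimes> x = x}"
      using eu uc i by (auto simp: Us_def)
    ultimately have "v \<in> {x \<in> carrier R. e i \<otimes> x = x}"
      using subalgebra_Span_incl[OF K, of _ Us, folded E_def] v by blast
    then show ?thesis
      by (metis (mono_tags, lifting) imageI mem_Collect_eq)
  qed
  ultimately have "E = (\<otimes>) (e i) ` carrier R"
    by blast
  then show ?thesis
    using dimension_independent[OF Us] by (simp add: E_def Us_def)
qed

section \<open>Scalar extension of algebras\<close>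

text \<open>\<open>extend_basis {}\<close> serves throughout as a chosen basis of the whole space,
  possibly infinite.\<close>

lemma (in vector_space) extend_basis_empty:
  "independent (extend_basis {})" "span (extend_basis {}) = UNIV"
  using independent_extend_basis[of "{}"] span_extend_basis[of "{}"] independent_empty by auto

lemma (in vector_space) representation_add_extend_basis:
  "representation (extend_basis {}) (x + y) b =
     representation (extend_basis {}) x b + representation (extend_basis {}) y b"
  "representation (extend_basis {}) (scale r x) b = r * representation (extend_basis {}) x b"
  using extend_basis_empty by (simp_all add: representation_add representation_scale)

lemma ring_of_type_algebra_ring: "ring (ring_of_type_algebra :: 'a::ring_1 ring)"
proof -
  have "\<exists>y. x + y = 0" "\<exists>y. y + x = 0" for x :: 'a
    by (intro exI[of _ "- x"]; simp)+
  then show ?thesis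
    unfolding ring_of_type_algebra_def by unfold_locales (auto simp: algebra_simps Units_def)
qed

section \<open>Coordinates and dimension of the scalar extension\<close>

locale scalar_extension = algebra_pair scA scS
  for scA :: "'f::field \<Rightarrow> 'a::ring_1 \<Rightarrow> 'a" and scS :: "'f \<Rightarrow> 's::field \<Rightarrow> 's"
begin

abbreviation "AS \<equiv> tensor_ring scA scS"
abbreviation "cls \<equiv> tensor_class scA scS"

sublocale AS: ring AS
  by (rule ring_tensor_ring)

text \<open>This is \<open>\<phi> \<otimes> id\<close> for an \<open>F\<close>-linear functional
  \<open>\<phi>\<close> on \<open>A\<close>, with values in \<open>F\<^sub>s\<close>; its
  counterpart \<open>balanced_right\<close> is \<open>id \<otimes> \<psi>\<close>, with values in
  \<open>A\<close>.\<close>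

lemma balanced_left:
  assumes "\<And>x y. \<phi> (x + y) = \<phi> x + \<phi> y" "\<And>r x. \<phi> (scA r x) = r * \<phi> x"
  shows "balanced scA scS (\<lambda>(a, s). scS (\<phi> a) s)"
  using assms by (simp add: balanced_def B.scale_left_distrib B.scale_right_distrib mult.commute)

lemma balanced_right:
  assumes "\<And>x y. \<psi> (x + y) = \<psi> x + \<psi> y" "\<And>r x. \<psi> (scS r x) = r * \<psi> x"
  shows "balanced scA scS (\<lambda>(a, s). scA (\<psi> s) a)"
  using assms by (simp add: balanced_def A.scale_left_distrib A.scale_right_distrib mult.commute)

definition coord :: "'a \<Rightarrow> ('a \<times> 's \<Rightarrow>\<^sub>0 int) \<Rightarrow> 's" where
  "coord b = pair_extend (\<lambda>(a, s). scS (A.representation (A.extend_basis {}) a b) s)"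

lemma coord_ideal: "x \<in> I \<Longrightarrow> coord b x = 0"
  unfolding coord_def
  by (rule pair_extend_ideal) (auto intro!: balanced_left simp: A.representation_add_extend_basis)

lemma coord_simps [simp]:
  "coord b 0 = 0" "coord b (x - y) = coord b x - coord b y"
  "coord b (frag_of (a, s)) = scS (A.representation (A.extend_basis {}) a b) s"
  by (simp_all add: coord_def pair_extend_diff)

lemma coord_mult: "coord b (pair_mult (frag_of (1, s)) x) = s * coord b x"
  by (induction x rule: frag_induct)
    (simp_all add: pair_mult_diff_right right_diff_distrib B.scale_mult_right)

text \<open>The coordinates of \<open>a \<otimes> s\<close> are those of \<open>a\<close> multiplied
  by \<open>s\<close>; for \<open>s \<noteq> 0\<close> they all vanish only if \<open>a\<close>
  does. In particular \<open>A\<^sub>s\<close> is not the zero ring.\<close>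

lemma frag_in_ideal_iff: "frag_of (a, s) \<in> I \<longleftrightarrow> a = 0 \<or> s = 0"
proof
  assume I: "frag_of (a, s) \<in> I"
  show "a = 0 \<or> s = 0"
  proof (rule disjCI)
    assume "s \<noteq> 0"
    then have "A.representation (A.extend_basis {}) a b = 0" for b
      using coord_ideal[OF I, of b] by simp
    then show "a = 0"
      using A.sum_nonzero_representation_eq[of "A.extend_basis {}" a] A.extend_basis_empty by simp
  qed
qed (auto simp: frag_zero_left frag_zero_right)

lemma one_not_zero: "\<one>\<^bsub>AS\<^esub> \<noteq> \<zero>\<^bsub>AS\<^esub>"
  by (simp add: tensor_class_simps tensor_class_eq_iff frag_in_ideal_iff)

lemma ext_scalars_eq: "ext_scalars scA scS = (\<lambda>s. cls (frag_of (1, s))) ` UNIV"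
  by (simp add: ext_scalars_def pure_tensor_eq_class)

lemma subfield_ext_scalars: "subfield (ext_scalars scA scS) AS"
proof -
  let ?S = "ring_of_type_algebra :: 's ring"
  interpret S: field ?S
    by (rule field_from_type_algebra)
  interpret h: ring_hom_ring ?S AS "\<lambda>s. cls (frag_of (1, s))"
    by (rule ring_hom_ringI2[OF S.ring_axioms AS.ring_axioms], rule ring_hom_memI)
      (auto simp: ring_of_type_algebra_def tensor_class_simps tensor_class_eq_iff zero_ideal
        intro: frag_add_right[of 1 _ _ scA scS, simplified diff_diff_eq])
  have "subfield ((\<lambda>s. cls (frag_of (1, s))) ` carrier ?S) AS"
    by (rule h.img_is_subfield(2)[OF S.carrier_is_subfield one_not_zero])
  then show ?thesis
    by (simp add: ext_scalars_eq ring_of_type_algebra_def)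
qed

lemma scalar_commute:
  fixes x :: "'a \<times> 's \<Rightarrow>\<^sub>0 int"
  shows "pair_mult (frag_of (1, s)) x = pair_mult x (frag_of (1, s))"
  by (induction x rule: frag_induct) (simp_all add: pair_mult_diff_left pair_mult_diff_right mult.commute[of s])

lemma ext_scalars_central:
  "k \<in> ext_scalars scA scS \<Longrightarrow> x \<in> carrier AS \<Longrightarrow> k \<otimes>\<^bsub>AS\<^esub> x = x \<otimes>\<^bsub>AS\<^esub> k"
  by (auto simp: ext_scalars_eq carrier_tensor_ring tensor_class_simps scalar_commute)

text \<open>For \<open>b\<close> in a basis of \<open>A\<close> over \<open>F\<close>, the elements
  \<open>b \<otimes> 1\<close> form a basis of \<open>A\<^sub>s\<close> over
  \<open>F\<^sub>s\<close>: the kernels of the coordinates separate them, and moving scalars across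
  the tensor sign shows that they span.\<close>

lemma dimension_carrier:
  assumes "finite (A.extend_basis {})"
  shows "AS.dimension (A.dim UNIV) (ext_scalars scA scS) (carrier AS)"
proof -
  let ?B = "A.extend_basis {}"
  note B = A.extend_basis_empty
  let ?K = "ext_scalars scA scS"
  obtain bs where bs: "set bs = ?B" "distinct bs"
    using finite_distinct_list[OF assms] by blast
  define u where "u b = cls (frag_of (b, 1))" for b
  have repr: "A.representation ?B b b' = (if b = b' then 1 else 0)" if "b \<in> ?B" for b b'
    using A.representation_basis[OF B(1) that] by auto
  have "AS.independent ?K (map u bs)"
  proof (rule AS.independent_mapI[OF subfield_ext_scalars bs(2), where W = "\<lambda>b. cls ` {x. coord b x = 0}"])
    fix b assume b: "b \<in> set bs"
    have "subgroup (cls ` {x. coord b x = 0}) (add_monoid AS)"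
      by (rule subgroup_tensor_class) auto
    then show "subalgebra ?K (cls ` {x. coord b x = 0}) AS"
      by (auto simp: subalgebra_def subalgebra_axioms_def ext_scalars_eq tensor_class_mult coord_mult)
    \<comment> \<open>The coordinate agrees on all representatives of a class, so its value 1 at
      \<open>b \<otimes> 1\<close> excludes a representative with value 0.\<close>
    show "u b \<notin> cls ` {x. coord b x = 0}"
    proof
      assume "u b \<in> cls ` {x. coord b x = 0}"
      then obtain x where "coord b x = 0" "frag_of (b, 1) - x \<in> I"
        by (auto simp: u_def tensor_class_eq_iff)
      then show False
        using coord_ideal[of "frag_of (b, 1) - x" b] b bs repr by simp
    qed
    show "u b' \<in> cls ` {x. coord b x = 0}" if "b' \<in> set bs" "b \<noteq> b'" for b'
      using that bs repr by (auto simp: u_def)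
  qed (auto simp: u_def)
  note ind = this
  have uc: "set (map u bs) \<subseteq> carrier AS"
    by (auto simp: u_def)
  define E where "E = AS.Span ?K (map u bs)"
  note SU = AS.Span_subgroup_props[OF subfield_ext_scalars uc, folded E_def]
    AS.Span_smult_closed[OF subfield_ext_scalars uc, folded E_def]
    AS.Span_base_incl[OF subfield_ext_scalars uc, folded E_def]
  have "cls x \<in> E" for x
  proof (induction x rule: frag_induct)
    case zero
    then show ?case
      using SU(2) by (simp add: tensor_ring_zero)
  next
    case (diff x y)
    then have "cls x \<oplus>\<^bsub>AS\<^esub> \<ominus>\<^bsub>AS\<^esub> cls y \<in> E"
      using SU by blast
    then show ?case
      by (simp add: tensor_class_simps)
  next
    case (one a s)
    let ?r = "A.representation ?B a"
    have mem: "cls (frag_of (b, scS (?r b) s)) \<in> E" if "b \<in> ?B" for b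
    proof -
      have "cls (frag_of (1, scS (?r b) s)) \<otimes>\<^bsub>AS\<^esub> u b \<in> E"
        using SU(5) SU(6) that bs by (auto simp: ext_scalars_eq)
      then show ?thesis
        by (simp add: u_def tensor_class_mult)
    qed
    have sum: "cls (\<Sum>b\<in>C. frag_of (b, scS (?r b) s)) \<in> E" if "C \<subseteq> ?B" for C
      using that
    proof (induction C rule: infinite_finite_induct)
      case (insert b C)
      then show ?case
        using SU(3)[OF mem, of b] by (simp add: tensor_class_add[symmetric])
    qed (use SU(2) in \<open>simp_all add: tensor_ring_zero\<close>)
    have a: "a = (\<Sum>b\<in>?B. scA (?r b) b)"
      using A.sum_representation_eq[OF B(1) _ assms] B(2) by simp
    have "frag_of (a, s) - (\<Sum>b\<in>?B. frag_of (scA (?r b) b, s)) \<in> I"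
      by (subst (1) a) (rule frag_sum_left)
    moreover have "(\<Sum>b\<in>?B. frag_of (scA (?r b) b, s)) - (\<Sum>b\<in>?B. frag_of (b, scS (?r b) s)) \<in> I"
      unfolding sum_subtractf[symmetric] by (rule sum_ideal) (rule frag_scale)
    ultimately have "frag_of (a, s) - (\<Sum>b\<in>?B. frag_of (b, scS (?r b) s)) \<in> I"
      by (rule ideal_trans)
    then have "cls (frag_of (a, s)) = cls (\<Sum>b\<in>?B. frag_of (b, scS (?r b) s))"
      by (simp add: tensor_class_eq_iff)
    then show ?case
      using sum by simp
  qed
  then have "E = carrier AS"
    using SU(1) by (auto simp: carrier_tensor_ring)
  moreover have "length (map u bs) = A.dim UNIV"
    using A.dim_eq_card[OF _ B(1), of UNIV] B(2) distinct_card[OF bs(2)] bs(1) A.span_UNIV by simp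
  ultimately show ?thesis
    using AS.dimension_independent[OF ind] by (simp only: E_def)
qed

end


section \<open>Scalar extensions of central simple algebras are prime\<close>

context scalar_extension
begin

text \<open>The opposite kind of coordinate: along a basis of \<open>F\<^sub>s\<close> over
  \<open>F\<close>, with values in \<open>A\<close>. It respects left and right multiplication by
  \<open>A\<close>, so it turns ideals of \<open>A\<^sub>s\<close> into ideals of
  \<open>A\<close>.\<close>

definition rcoord :: "'s \<Rightarrow> ('a \<times> 's \<Rightarrow>\<^sub>0 int) \<Rightarrow> 'a" where
  "rcoord c = pair_extend (\<lambda>(a, s). scA (B.representation (B.extend_basis {}) s c) a)"

lemma rcoord_ideal: "x \<in> I \<Longrightarrow> rcoord c x = 0"
  unfolding rcoord_def
  by (rule pair_extend_ideal) (auto intro!: balanced_right simp: B.representation_add_extend_basis)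

lemma rcoord_simps [simp]:
  "rcoord c 0 = 0" "rcoord c (x - y) = rcoord c x - rcoord c y"
  "rcoord c (x + y) = rcoord c x + rcoord c y" "rcoord c (- x) = - rcoord c x"
  "rcoord c (frag_of (a, s)) = scA (B.representation (B.extend_basis {}) s c) a"
  by (simp_all add: rcoord_def pair_extend_diff pair_extend_add pair_extend_minus)

lemma rcoord_mult_left: "rcoord c (pair_mult (frag_of (a, 1)) x) = a * rcoord c x"
  by (induction x rule: frag_induct)
    (simp_all add: pair_mult_diff_right right_diff_distrib A.scale_mult_right)

lemma rcoord_mult_right: "rcoord c (pair_mult x (frag_of (a, 1))) = rcoord c x * a"
  by (induction x rule: frag_induct)
    (simp_all add: pair_mult_diff_left left_diff_distrib A.scale_mult_left)

text \<open>The expansion is claimed over every finite superset of \<open>K\<close> because the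
  induction step for \<open>x - y\<close> needs one index set serving both elements; the extra terms
  have coordinate 0.\<close>

lemma rcoord_expansion_aux:
  "\<exists>K. finite K \<and> (\<forall>c. rcoord c x \<noteq> 0 \<longrightarrow> c \<in> K) \<and>
     (\<forall>K'. finite K' \<longrightarrow> K \<subseteq> K' \<longrightarrow> x - (\<Sum>c\<in>K'. frag_of (rcoord c x, c)) \<in> I)"
proof (induction x rule: frag_induct)
  case zero
  show ?case
    by (rule exI[of _ "{}"]) (auto intro!: minus_ideal sum_ideal frag_zero_left)
next
  case (one a s)
  let ?r = "B.representation (B.extend_basis {}) s"
  let ?K = "{c. ?r c \<noteq> 0}"
  have expand: "frag_of (a, s) - (\<Sum>c\<in>K'. frag_of (rcoord c (frag_of (a, s)), c)) \<in> I"
    if "finite K'" "?K \<subseteq> K'" for K'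
  proof -
    have "s = (\<Sum>c\<in>?K. scS (?r c) c)"
      using B.sum_nonzero_representation_eq[of "B.extend_basis {}" s] B.extend_basis_empty by simp
    also have "\<dots> = (\<Sum>c\<in>K'. scS (?r c) c)"
      by (rule sum.mono_neutral_left) (use that in auto)
    finally have s: "s = (\<Sum>c\<in>K'. scS (?r c) c)" .
    have "frag_of (a, s) - (\<Sum>c\<in>K'. frag_of (a, scS (?r c) c)) \<in> I"
      by (subst (1) s) (rule frag_sum_right)
    moreover have "(\<Sum>c\<in>K'. frag_of (a, scS (?r c) c)) - (\<Sum>c\<in>K'. frag_of (scA (?r c) a, c)) \<in> I"
      unfolding sum_subtractf[symmetric] by (rule sum_ideal) (rule ideal_sym[OF frag_scale])
    ultimately show ?thesis
      unfolding rcoord_simps by (rule ideal_trans)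
  qed
  have supp: "c \<in> ?K" if "rcoord c (frag_of (a, s)) \<noteq> 0" for c
    using that by auto
  show ?case
    by (intro exI[of _ ?K] conjI allI impI)
      (rule B.finite_representation supp expand, assumption?)+
next
  case (diff x y)
  obtain K where K: "finite K" "\<forall>c. rcoord c x \<noteq> 0 \<longrightarrow> c \<in> K"
    "\<forall>K'. finite K' \<longrightarrow> K \<subseteq> K' \<longrightarrow> x - (\<Sum>c\<in>K'. frag_of (rcoord c x, c)) \<in> I"
    using diff(1) by (elim exE conjE) (rule that)
  obtain L where L: "finite L" "\<forall>c. rcoord c y \<noteq> 0 \<longrightarrow> c \<in> L"
    "\<forall>K'. finite K' \<longrightarrow> L \<subseteq> K' \<longrightarrow> y - (\<Sum>c\<in>K'. frag_of (rcoord c y, c)) \<in> I"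
    using diff(2) by (elim exE conjE) (rule that)
  have expand: "x - y - (\<Sum>c\<in>M. frag_of (rcoord c (x - y), c)) \<in> I" if "finite M" "K \<union> L \<subseteq> M" for M
  proof -
    have xy: "(x - (\<Sum>c\<in>M. frag_of (rcoord c x, c))) - (y - (\<Sum>c\<in>M. frag_of (rcoord c y, c))) \<in> I"
      by (rule diff_ideal[OF K(3)[rule_format] L(3)[rule_format]]) (use that in auto)
    have "(\<Sum>c\<in>M. frag_of (rcoord c x - rcoord c y, c) -
        (frag_of (rcoord c x, c) - frag_of (rcoord c y, c))) \<in> I"
      by (rule sum_ideal) (rule frag_diff_left)
    from diff_ideal[OF xy this] show ?thesis
      by (simp add: sum_subtractf sum.distrib algebra_simps)
  qed
  have supp: "c \<in> K \<union> L" if "rcoord c (x - y) \<noteq> 0" for c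
    using that K(2) L(2) by (cases "rcoord c x = 0") auto
  show ?case
    by (intro exI[of _ "K \<union> L"] conjI allI impI)
      (rule finite_UnI K(1) L(1) supp expand, assumption?)+
qed

lemma finite_rcoord: "finite {c. rcoord c x \<noteq> 0}"
proof -
  obtain K where "finite K" "{c. rcoord c x \<noteq> 0} \<subseteq> K"
    using rcoord_expansion_aux[of x] by blast
  then show ?thesis
    by (rule rev_finite_subset)
qed

lemma rcoord_expansion:
  "\<exists>K. x - (\<Sum>c\<in>K. frag_of (rcoord c x, c)) \<in> I"
  using rcoord_expansion_aux[of x] by blast

text \<open>Converse of \<open>rcoord_ideal\<close>: every term of the expansion vanishes. It
  supplies the nonzero coordinate at which an element is normalized.\<close>

lemma rcoord_eq_zero: "(\<And>c. rcoord c x = 0) \<Longrightarrow> x \<in> I"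
proof -
  assume 0: "\<And>c. rcoord c x = 0"
  obtain K where "x - (\<Sum>c\<in>K. frag_of (rcoord c x, c)) \<in> I"
    using rcoord_expansion by blast
  moreover have "(\<Sum>c\<in>K. frag_of (rcoord c x, c)) \<in> I"
    by (rule sum_ideal) (simp add: 0 frag_zero_left)
  ultimately show "x \<in> I"
    using add_ideal by fastforce
qed

text \<open>An element of minimal support with respect to a basis of the extension field can be
  normalized to have a coordinate 1; its commutators with the algebra have smaller support,
  so all its coordinates are scalars and it is a pure tensor.\<close>

lemma two_sided_ideal_one:
  assumes simple: "central_simple scA n"
    and diff: "\<And>x y. x \<in> J \<Longrightarrow> y \<in> J \<Longrightarrow> x - y \<in> J"
    and left: "\<And>x z. x \<in> J \<Longrightarrow> pair_mult z x \<in> J"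
    and right: "\<And>x z. x \<in> J \<Longrightarrow> pair_mult x z \<in> J"
    and sub: "I \<subseteq> J" and x0: "x0 \<in> J" "x0 \<notin> I"
  shows "frag_of (1, 1) \<in> J"
proof -
  define supp where "supp x = {c. rcoord c x \<noteq> 0}" for x
  have fin: "finite (supp x)" for x
    unfolding supp_def by (rule finite_rcoord)
  have suppD: "rcoord d y = 0" if "supp y \<subseteq> supp x" "rcoord d x = 0" for d x y
    using that by (auto simp: supp_def)
  have zero: "0 \<in> J"
    using sub zero_ideal[of scA scS] by blast
  obtain x where x: "x \<in> J" "x \<notin> I" and min: "\<And>y. y \<in> J \<Longrightarrow> y \<notin> I \<Longrightarrow> card (supp x) \<le> card (supp y)"
    using ex_has_least_nat[of "\<lambda>x. x \<in> J \<and> x \<notin> I" x0 "\<lambda>x. card (supp x)"] x0 by blast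
  obtain c where c: "rcoord c x \<noteq> 0"
    using rcoord_eq_zero x(2) by blast
  \<comment> \<open>The normalization: these coefficients at \<open>c\<close> form a two-sided ideal
    of \<open>A\<close>, nonzero because of \<open>x\<close>, so by simplicity 1 is among
    them.\<close>
  define K where "K = {rcoord c y | y. y \<in> J \<and> supp y \<subseteq> supp x}"
  have memK: "rcoord c y \<in> K" if "y \<in> J" "supp y \<subseteq> supp x" for y
    using that by (auto simp: K_def)
  interpret A': ring "ring_of_type_algebra :: 'a ring"
    by (rule ring_of_type_algebra_ring)
  have "ideal K (ring_of_type_algebra :: 'a ring)"
  proof (rule idealI[OF ring_of_type_algebra_ring])
    have minusA: "\<ominus>\<^bsub>ring_of_type_algebra\<^esub> a = - a" for a :: 'a
      by (rule A'.minus_equality) (auto simp: ring_of_type_algebra_def)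
    have diffK: "a - b \<in> K" if "a \<in> K" "b \<in> K" for a b
    proof -
      from that obtain y z where yz: "y \<in> J" "supp y \<subseteq> supp x" "a = rcoord c y"
        "z \<in> J" "supp z \<subseteq> supp x" "b = rcoord c z"
        by (auto simp: K_def)
      have "supp (y - z) \<subseteq> supp x"
        using suppD[OF yz(2)] suppD[OF yz(5)] by (auto simp: supp_def[of x] supp_def[of "y - z"])
      then show ?thesis
        using memK[of "y - z"] yz diff by simp
    qed
    have zeroK: "0 \<in> K"
      using memK[OF zero] by (simp add: supp_def)
    have uminusK: "- a \<in> K" if "a \<in> K" for a
      using diffK[OF zeroK that] by simp
    have addK: "a + b \<in> K" if "a \<in> K" "b \<in> K" for a b
      using diffK[OF that(1) uminusK[OF that(2)]] by simp
    show "subgroup K (add_monoid (ring_of_type_algebra :: 'a ring))"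
    proof (rule A'.add.subgroupI)
      show "\<ominus>\<^bsub>ring_of_type_algebra\<^esub> a \<in> K" if "a \<in> K" for a
        using uminusK[OF that] minusA[of a] by simp
    qed (use zeroK addK in \<open>auto simp: ring_of_type_algebra_def\<close>)
    fix a b assume "a \<in> K"
    then obtain y where y: "y \<in> J" "supp y \<subseteq> supp x" "a = rcoord c y"
      by (auto simp: K_def)
    have "supp (pair_mult (frag_of (b, 1)) y) \<subseteq> supp x" "supp (pair_mult y (frag_of (b, 1))) \<subseteq> supp x"
      using suppD[OF y(2)]
      by (auto simp: supp_def[of x] supp_def[of "pair_mult _ _"] rcoord_mult_left rcoord_mult_right)
    then show "b \<otimes>\<^bsub>ring_of_type_algebra\<^esub> a \<in> K" "a \<otimes>\<^bsub>ring_of_type_algebra\<^esub> b \<in> K"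
      using memK left[OF y(1)] right[OF y(1)] y(3)
      by (auto simp: ring_of_type_algebra_def rcoord_mult_left[symmetric] rcoord_mult_right[symmetric])
  qed
  then have "K = {0} \<or> K = UNIV"
    using simple unfolding central_simple_def by blast
  moreover have "rcoord c x \<in> K"
    using memK x(1) by blast
  ultimately have "1 \<in> K"
    using c by auto
  then obtain y where y: "y \<in> J" "supp y \<subseteq> supp x" "rcoord c y = 1"
    by (force simp: K_def)
  have comm: "a * rcoord d y = rcoord d y * a" for a d
  proof -
    \<comment> \<open>At \<open>c\<close> the commutator has coordinate
      \<open>a * 1 - 1 * a = 0\<close>, so \<open>c\<close> leaves the support and minimality puts
      the commutator into \<open>I\<close>.\<close>
    let ?z = "pair_mult (frag_of (a, 1)) y - pair_mult y (frag_of (a, 1))"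
    have z: "rcoord d ?z = a * rcoord d y - rcoord d y * a" for d
      by (simp add: rcoord_mult_left rcoord_mult_right)
    have "supp ?z \<subseteq> supp x - {c}"
      using y(3) suppD[OF y(2)]
      by (auto simp: supp_def[of x] supp_def[of "_ - _"] rcoord_mult_left rcoord_mult_right)
    then have "card (supp ?z) < card (supp x)"
      using c fin[of x] by (intro psubset_card_mono) (auto simp: supp_def)
    then have "?z \<in> I"
      using min[of ?z] diff left[OF y(1)] right[OF y(1)] by fastforce
    then show ?thesis
      using rcoord_ideal[of ?z d] z[of d] by simp
  qed
  have "\<exists>r. rcoord d y = scA r 1" for d
  proof -
    have "rcoord d y \<in> {z. \<forall>x. z * x = x * z}"
      using comm[of _ d] by simp
    then show ?thesis
      using simple unfolding central_simple_def by blast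
  qed
  then obtain r where r: "\<And>d. rcoord d y = scA (r d) 1"
    by metis
  obtain M where M: "y - (\<Sum>d\<in>M. frag_of (rcoord d y, d)) \<in> I"
    using rcoord_expansion by blast
  define s where "s = (\<Sum>d\<in>M. scS (r d) d)"
  have "(\<Sum>d\<in>M. frag_of (rcoord d y, d)) - (\<Sum>d\<in>M. frag_of (1, scS (r d) d)) \<in> I"
    unfolding sum_subtractf[symmetric] r by (rule sum_ideal) (rule frag_scale)
  moreover have "(\<Sum>d\<in>M. frag_of (1, scS (r d) d)) - frag_of (1, s) \<in> I"
    unfolding s_def by (rule ideal_sym[OF frag_sum_right])
  ultimately have ys: "y - frag_of (1, s) \<in> I"
    using M ideal_trans by blast
  \<comment> \<open>The coordinate 1 at \<open>c\<close> keeps \<open>y\<close> out of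
    \<open>I\<close>; once \<open>s\<close> is nonzero, \<open>1 \<otimes> s\<close> is a unit
    inside \<open>J\<close>.\<close>
  have "s \<noteq> 0"
  proof
    assume "s = 0"
    then have "y \<in> I"
      using add_ideal[OF ys frag_zero_right[of 1]] by simp
    then show False
      using rcoord_ideal[of y c] y(3) by simp
  qed
  have "frag_of (1, s) \<in> J"
    using diff[OF y(1), of "y - frag_of (1, s)"] ys sub by auto
  then show ?thesis
    using right[of "frag_of (1, s)" "frag_of (1, inverse s)"] \<open>s \<noteq> 0\<close> by simp
qed

text \<open>For fixed \<open>y\<close>, the \<open>x\<close> such that x z y vanishes for all z form
  a two-sided ideal. If it were nonzero it would contain 1, and z = 1 would make \<open>y\<close>
  vanish.\<close>

lemma tensor_prime:
  assumes "central_simple scA n" "x \<notin> I" "y \<notin> I"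
  shows "\<exists>z. pair_mult (pair_mult x z) y \<notin> I"
proof (rule ccontr)
  assume no: "\<nexists>z. pair_mult (pair_mult x z) y \<notin> I"
  let ?J = "{x. \<forall>z. pair_mult (pair_mult x z) y \<in> I}"
  have "frag_of (1, 1) \<in> ?J"
  proof (rule two_sided_ideal_one[OF assms(1), where ?x0.0 = x])
    fix u v assume u: "u \<in> ?J"
    then show "u - v \<in> ?J" if "v \<in> ?J"
      using that by (simp add: pair_mult_diff_left diff_ideal)
    show "pair_mult v u \<in> ?J"
      using u by (simp add: pair_mult_assoc mult_left_ideal)
    show "pair_mult u v \<in> ?J"
      using u by (simp add: pair_mult_assoc[of u v])
  qed (use no assms in \<open>auto intro: mult_right_ideal\<close>)
  then have "pair_mult (pair_mult (frag_of (1, 1)) (frag_of (1, 1))) y \<in> I"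
    by blast
  then show False
    using assms(3) by (simp add: pair_mult_one)
qed

end


section \<open>The Galois action on points\<close>

lemma algebra_homI:
  assumes "vector_space scA" "vector_space scB"
    and "\<And>x y. h (x + y) = h x + h y" "\<And>r x. h (scA r x) = scB r (h x)"
    and "h 1 = 1" "\<And>x y. h (x * y) = h x * h y"
  shows "algebra_hom scA scB h"
  using assms by (simp add: algebra_hom_def Vector_Spaces.linear_iff)

lemma algebra_hom_spaces:
  assumes "algebra_hom scA scB h"
  shows "vector_space scA" "vector_space scB"
  using assms by (simp_all add: algebra_hom_def Vector_Spaces.linear_iff)

lemma algebra_hom_compose:
  assumes "algebra_hom scA scB g" "algebra_hom scB scC h"
  shows "algebra_hom scA scC (h \<circ> g)"
  using assms by (intro algebra_homI) (simp_all add: algebra_homD algebra_hom_spaces)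

lemma algebra_hom_id: "vector_space scA \<Longrightarrow> algebra_hom scA scA id"
  by (intro algebra_homI) simp_all

lemma algebra_hom_inv:
  assumes h: "algebra_hom scA scB h" and "bij h"
  shows "algebra_hom scB scA (inv_into UNIV h)"
proof -
  have inv: "inv_into UNIV h (h x) = x" "h (inv_into UNIV h y) = y" for x y
    using \<open>bij h\<close> by (simp_all add: bij_is_inj bij_is_surj surj_f_inv_f)
  have eq: "inv_into UNIV h y = x" if "h x = y" for x y
    using inv(1)[of x] that by simp
  show ?thesis
    by (intro algebra_homI algebra_hom_spaces[OF h] eq) (simp_all add: algebra_homD[OF h] inv)
qed

lemma mem_galois_group: "\<gamma> \<in> carrier (galois_group scS) \<longleftrightarrow> algebra_hom scS scS \<gamma> \<and> bij \<gamma>"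
  by (simp add: galois_group_def)

lemma inv_galois_group:
  "\<gamma> \<in> carrier (galois_group scS) \<Longrightarrow> inv_into UNIV \<gamma> \<in> carrier (galois_group scS)"
  by (simp add: mem_galois_group algebra_hom_inv bij_imp_bij_inv)

lemma group_galois_group:
  assumes "vector_space scS"
  shows "group (galois_group scS)"
proof (rule groupI)
  fix \<gamma> assume \<gamma>: "\<gamma> \<in> carrier (galois_group scS)"
  show "\<exists>\<delta>\<in>carrier (galois_group scS). \<delta> \<otimes>\<^bsub>galois_group scS\<^esub> \<gamma> = \<one>\<^bsub>galois_group scS\<^esub>"
    using inv_galois_group[OF \<gamma>] \<gamma>
    by (intro bexI[of _ "inv_into UNIV \<gamma>"]) (auto simp: galois_group_def bij_is_inj)
qed (use assms in \<open>auto simp: galois_group_def algebra_hom_compose algebra_hom_id bij_comp\<close>)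

lemma alg_points_compose:
  "\<gamma> \<in> carrier (galois_group scS) \<Longrightarrow> \<xi> \<in> alg_points scS scL \<Longrightarrow> \<gamma> \<circ> \<xi> \<in> alg_points scS scL"
  by (auto simp: mem_galois_group alg_points_def intro: algebra_hom_compose)

text \<open>\<open>Bij\<close> consists of extensional functions, which is why the action is
  restricted to the points. Composition with the inverse of \<open>\<gamma>\<close> inverts
  it.\<close>

lemma group_action_alg_points:
  assumes "vector_space scS"
  shows "group_action (galois_group scS) (alg_points scS scL) (alg_points_action scS scL)"
proof -
  let ?G = "galois_group scS" and ?X = "alg_points scS scL" and ?act = "alg_points_action scS scL"
  have bij: "?act \<gamma> \<in> Bij ?X" if \<gamma>: "\<gamma> \<in> carrier ?G" for \<gamma>
  proof -
    have "bij \<gamma>"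
      using \<gamma> by (simp add: mem_galois_group)
    have "bij_betw (?act \<gamma>) ?X ?X"
    proof (rule bij_betwI[where g = "\<lambda>\<xi>. inv_into UNIV \<gamma> \<circ> \<xi>"])
      show "?act \<gamma> \<in> ?X \<rightarrow> ?X"
        using alg_points_compose[OF \<gamma>] by (auto simp: alg_points_action_def)
      show "(\<lambda>\<xi>. inv_into UNIV \<gamma> \<circ> \<xi>) \<in> ?X \<rightarrow> ?X"
        using alg_points_compose[OF inv_galois_group[OF \<gamma>]] by auto
    next
      fix \<xi> assume "\<xi> \<in> ?X"
      then show "inv_into UNIV \<gamma> \<circ> ?act \<gamma> \<xi> = \<xi>" "?act \<gamma> (inv_into UNIV \<gamma> \<circ> \<xi>) = \<xi>"
        using alg_points_compose[OF inv_galois_group[OF \<gamma>]] \<open>bij \<gamma>\<close>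
        by (auto simp: alg_points_action_def fun_eq_iff bij_is_inj bij_is_surj surj_f_inv_f)
    qed
    then show ?thesis
      by (simp add: Bij_def alg_points_action_def)
  qed
  have "?act \<in> hom ?G (BijGroup ?X)"
  proof (rule homI)
    fix \<gamma> \<delta> assume \<gamma>\<delta>: "\<gamma> \<in> carrier ?G" "\<delta> \<in> carrier ?G"
    then show "?act (\<gamma> \<otimes>\<^bsub>?G\<^esub> \<delta>) = ?act \<gamma> \<otimes>\<^bsub>BijGroup ?X\<^esub> ?act \<delta>"
      using alg_points_compose[OF \<gamma>\<delta>(2), of _ scL] bij
      by (auto simp: BijGroup_def galois_group_def compose_def alg_points_action_def fun_eq_iff)
  qed (use bij in \<open>simp add: BijGroup_def\<close>)
  then show ?thesis
    by (simp add: group_action_def group_hom_def group_hom_axioms_def group_galois_group[OF assms]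
        group_BijGroup)
qed

text \<open>Finitely many points are separated by finitely many elements \<open>l\<close>, so the conjugate of \<open>\<xi>\<close> by
  \<open>\<gamma>\<close> depends only on the values of \<open>\<gamma>\<close> at the finitely many elements \<open>\<xi> l\<close>.\<close>

lemma continuous_alg_points_action:
  assumes fin: "finite (alg_points scS scL)"
  shows "continuous_map (prod_topology (krull_topology scS) (discrete_topology (alg_points scS scL)))
    (discrete_topology (alg_points scS scL)) (\<lambda>(\<gamma>, \<xi>). alg_points_action scS scL \<gamma> \<xi>)"
proof -
  let ?X = "alg_points scS scL" and ?act = "alg_points_action scS scL"
  let ?G = "carrier (galois_group scS)"
  let ?T = "prod_topology (krull_topology scS) (discrete_topology ?X)"
  have top: "topspace ?T = ?G \<times> ?X"
    by (simp add: krull_topology_def)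
  \<comment> \<open>One separating element for each pair of distinct points; a pair of equal points
    contributes an arbitrary element.\<close>
  define D where "D = (\<lambda>(\<xi>, \<eta>). SOME l. \<xi> l \<noteq> \<eta> l) ` (?X \<times> ?X)"
  have D: "\<exists>l\<in>D. \<xi> l \<noteq> \<eta> l" if "\<xi> \<in> ?X" "\<eta> \<in> ?X" "\<xi> \<noteq> \<eta>" for \<xi> \<eta>
  proof -
    have "\<exists>l. \<xi> l \<noteq> \<eta> l"
      using that(3) by auto
    then have "\<xi> (SOME l. \<xi> l \<noteq> \<eta> l) \<noteq> \<eta> (SOME l. \<xi> l \<noteq> \<eta> l)"
      by (rule someI_ex)
    then show "\<exists>l\<in>D. \<xi> l \<noteq> \<eta> l"
      using that(1,2) unfolding D_def by force
  qed
  have finD: "finite D"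
    unfolding D_def using fin by blast
  have nbhd: "\<exists>V. openin ?T V \<and> (\<gamma>, \<xi>) \<in> V \<and> (\<forall>(\<delta>, \<eta>)\<in>V. ?act \<delta> \<eta> = ?act \<gamma> \<xi>)"
    if \<gamma>: "\<gamma> \<in> ?G" and \<xi>: "\<xi> \<in> ?X" for \<gamma> \<xi>
  proof -
    \<comment> \<open>A basic open set of the product topology: agreement with
      \<open>\<gamma>\<close> is demanded only at the values of \<open>\<xi>\<close> on the finite
      set \<open>D\<close>.\<close>
    define U where "U s = (if s \<in> \<xi> ` D then {\<gamma> s} else UNIV)" for s
    define N where "N = PiE UNIV U \<inter> ?G"
    have "finite {s. U s \<noteq> UNIV}"
      by (rule finite_subset[of _ "\<xi> ` D"]) (auto simp: U_def finD)
    then have "openin (product_topology (\<lambda>_. discrete_topology UNIV) UNIV) (PiE UNIV U)"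
      by (intro product_topology_basis) auto
    then have "openin (krull_topology scS) (PiE UNIV U \<inter> ?G)"
      by (auto simp: krull_topology_def openin_subtopology)
    then have op: "openin ?T (N \<times> {\<xi>})"
      using \<xi> by (simp add: N_def openin_prod_Times_iff)
    have mem: "(\<gamma>, \<xi>) \<in> N \<times> {\<xi>}"
      using \<gamma> by (auto simp: N_def U_def)
    have act: "?act \<delta> \<xi> = ?act \<gamma> \<xi>" if \<delta>: "\<delta> \<in> N" for \<delta>
    proof -
      have "\<delta> (\<xi> l) = \<gamma> (\<xi> l)" if "l \<in> D" for l
      proof -
        have "\<delta> (\<xi> l) \<in> U (\<xi> l)"
          using \<delta> by (auto simp: N_def)
        then show ?thesis
          using that by (auto simp: U_def)
      qed
      moreover have "\<delta> \<in> ?G"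
        using \<delta> by (simp add: N_def)
      \<comment> \<open>Both compositions are again points, so agreement on \<open>D\<close> forces
        equality.\<close>
      ultimately have "\<delta> \<circ> \<xi> = \<gamma> \<circ> \<xi>"
        using D[OF alg_points_compose[of \<delta>, OF _ \<xi>] alg_points_compose[OF \<gamma> \<xi>]] by fastforce
      then show ?thesis
        using \<xi> by (simp add: alg_points_action_def)
    qed
    show ?thesis
      by (intro exI[of _ "N \<times> {\<xi>}"] conjI op mem) (use act in blast)
  qed
  \<comment> \<open>The action is locally constant, hence all preimages are open.\<close>
  have "openin ?T {p \<in> topspace ?T. (case p of (\<gamma>, \<xi>) \<Rightarrow> ?act \<gamma> \<xi>) \<in> W}" for W
  proof (subst openin_subopen, clarify)
    fix \<gamma> \<xi> assume p: "(\<gamma>, \<xi>) \<in> topspace ?T" "?act \<gamma> \<xi> \<in> W"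
    then obtain V where V: "openin ?T V" "(\<gamma>, \<xi>) \<in> V" "\<forall>(\<delta>, \<eta>)\<in>V. ?act \<delta> \<eta> = ?act \<gamma> \<xi>"
      using nbhd[of \<gamma> \<xi>] top by auto
    then have "V \<subseteq> {p \<in> topspace ?T. (case p of (\<gamma>, \<xi>) \<Rightarrow> ?act \<gamma> \<xi>) \<in> W}"
      using openin_subset[OF V(1)] p(2) by auto
    then show "\<exists>V. openin ?T V \<and> (\<gamma>, \<xi>) \<in> V \<and>
        V \<subseteq> {p \<in> topspace ?T. (case p of (\<gamma>, \<xi>) \<Rightarrow> ?act \<gamma> \<xi>) \<in> W}"
      using V by blast
  qed
  moreover have "?act \<gamma> \<xi> \<in> ?X" if "\<gamma> \<in> ?G" "\<xi> \<in> ?X" for \<gamma> \<xi>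
    using alg_points_compose[OF that] that by (simp add: alg_points_action_def)
  ultimately show ?thesis
    unfolding continuous_map_def using top by auto
qed

lemma galois_set_alg_points:
  assumes "vector_space scS" "finite (alg_points scS scL)"
  shows "galois_set scS (card (alg_points scS scL)) (alg_points scS scL) (alg_points_action scS scL)"
  using assms by (simp add: galois_set_def group_action_alg_points continuous_alg_points_action)

section \<open>Points of etale algebras\<close>

text \<open>For a point \<open>\<xi>\<close> this is the homomorphism
  \<open>\<xi> \<otimes> id\<close> from \<open>L\<^sub>s\<close> to \<open>F\<^sub>s\<close>, on
  representatives.\<close>

definition eval_point :: "('l \<Rightarrow> 's) \<Rightarrow> ('l \<times> 's \<Rightarrow>\<^sub>0 int) \<Rightarrow> 's::field" where
  "eval_point \<xi> = pair_extend (\<lambda>(l, s). \<xi> l * s)"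

lemma eval_point_simps [simp]:
  "eval_point \<xi> 0 = 0" "eval_point \<xi> (x - y) = eval_point \<xi> x - eval_point \<xi> y"
  "eval_point \<xi> (x + y) = eval_point \<xi> x + eval_point \<xi> y"
  "eval_point \<xi> (frag_of (l, s)) = \<xi> l * s"
  by (simp_all add: eval_point_def pair_extend_diff pair_extend_add)

lemma eval_point_sum: "eval_point \<xi> (sum x K) = (\<Sum>k\<in>K. eval_point \<xi> (x k))"
  by (simp add: eval_point_def pair_extend_sum)

lemma eval_point_mult:
  assumes "\<xi> \<in> alg_points scS scL"
  shows "eval_point \<xi> (pair_mult x y) = eval_point \<xi> x * eval_point \<xi> y"
proof (induction x rule: frag_induct)
  case (one l s)
  show ?case
    by (induction y rule: frag_induct)
      (use algebra_homD(7)[of scL scS \<xi>] assms in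
        \<open>simp_all add: pair_mult_diff_right alg_points_def algebra_simps\<close>)
qed (simp_all add: pair_mult_diff_left left_diff_distrib)

lemma eval_point_ideal:
  assumes "assoc_algebra scL" "assoc_algebra scS" "\<xi> \<in> alg_points scS scL"
    "x \<in> tensor_ideal scL scS"
  shows "eval_point \<xi> x = 0"
proof -
  interpret algebra_pair scL scS
    by (intro algebra_pair.intro assms)
  have \<xi>: "algebra_hom scL scS \<xi>"
    using assms by (simp add: alg_points_def)
  show ?thesis
    unfolding eval_point_def
    by (rule pair_extend_ideal[OF assms(4)])
      (simp add: balanced_def algebra_homD[OF \<xi>] algebra_simps B.scale_mult_left B.scale_mult_right)
qed

text \<open>The coordinates of the isomorphism \<open>\<phi>\<close> are evaluations at points
  \<open>\<xi> i\<close>, the \<open>e j\<close> lift the standard idempotents, and injectivity of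
  \<open>\<phi>\<close> gives the last conclusion, by which identities in \<open>L\<^sub>s\<close>
  are later checked pointwise.\<close>

lemma etale_idempotents:
  fixes scS :: "'f::field \<Rightarrow> 's::field \<Rightarrow> 's" and scL :: "'f \<Rightarrow> 'l::comm_ring_1 \<Rightarrow> 'l"
  assumes S: "assoc_algebra scS" and "etale scS scL n"
  obtains \<xi> :: "nat \<Rightarrow> 'l \<Rightarrow> 's" and e :: "nat \<Rightarrow> ('l \<times> 's \<Rightarrow>\<^sub>0 int)"
  where "\<And>i. i < n \<Longrightarrow> \<xi> i \<in> alg_points scS scL"
    and "\<And>i j. i < n \<Longrightarrow> j < n \<Longrightarrow> eval_point (\<xi> i) (e j) = (if i = j then 1 else 0)"
    and "\<And>x. (\<And>i. i < n \<Longrightarrow> eval_point (\<xi> i) x = 0) \<Longrightarrow> x \<in> tensor_ideal scL scS"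
proof -
  let ?R = "tensor_ring scL scS" and ?cls = "tensor_class scL scS"
  from assms(2) obtain \<phi> where \<phi>: "\<phi> \<in> ring_iso ?R (power_ring n)"
    and \<phi>S: "\<And>c. \<phi> (pure_tensor scL scS 1 c) = (\<lambda>i\<in>{..<n}. c)" and L: "assoc_algebra scL"
    by (auto simp: etale_def)
  interpret algebra_pair scL scS
    by (intro algebra_pair.intro L S)
  have hom: "\<phi> \<in> ring_hom ?R (power_ring n)" and bij: "bij_betw \<phi> (carrier ?R) (carrier (power_ring n))"
    using \<phi> by (auto simp: ring_iso_def)
  define p where "p i x = \<phi> (?cls x) i" for i x
  have p_add: "p i (x + y) = p i x + p i y" and p_mult: "p i (pair_mult x y) = p i x * p i y"
    and p_scalar: "p i (frag_of (1, c)) = c" if "i < n" for i x y c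
    using that ring_hom_add[OF hom, of "?cls x" "?cls y"] ring_hom_mult[OF hom, of "?cls x" "?cls y"] \<phi>S[of c]
    by (simp_all add: p_def tensor_class_add tensor_class_mult power_ring_def pure_tensor_eq_class)
  have p_diff: "p i (x - y) = p i x - p i y" if "i < n" for i x y
    using p_add[OF that, of "x - y" y] by simp
  have p_zero: "p i 0 = 0" if "i < n" for i
    using p_diff[OF that, of 0 0] by simp
  have p_cong: "p i x = p i y" if "x - y \<in> I" for i x y
    using that by (simp add: p_def tensor_class_eq_iff[symmetric])
  \<comment> \<open>Elements of \<open>power_ring n\<close> are extensional, so equality can be
    tested on the coordinates below \<open>n\<close>.\<close>
  have \<phi>_ext: "\<phi> (?cls x) \<in> extensional {..<n}" for x
  proof -
    have "\<phi> (?cls x) \<in> carrier (power_ring n)"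
      using bij_betwE[OF bij] by simp
    then show ?thesis
      by (auto simp: power_ring_def PiE_def)
  qed
  define \<xi> where "\<xi> i l = p i (frag_of (l, 1))" for i l
  \<comment> \<open>Here the compatibility of \<open>\<phi>\<close> with scalars enters, through
    \<open>l \<otimes> s = (l \<otimes> 1) (1 \<otimes> s)\<close>.\<close>
  have p_pure: "p i (frag_of (l, s)) = \<xi> i l * s" if "i < n" for i l s
    using p_mult[OF that, of "frag_of (l, 1)" "frag_of (1, s)"] p_scalar[OF that] by (simp add: \<xi>_def)
  have p_eval: "p i x = eval_point (\<xi> i) x" if "i < n" for i x
    by (induction x rule: frag_induct) (use that in \<open>simp_all add: p_zero p_diff p_pure\<close>)
  have \<xi>: "\<xi> i \<in> alg_points scS scL" if i: "i < n" for i
  proof -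
    have "algebra_hom scL scS (\<xi> i)"
    proof (rule algebra_homI)
      fix x y r
      show "\<xi> i (x + y) = \<xi> i x + \<xi> i y"
        using p_cong[OF frag_add_left[of x y 1, unfolded diff_diff_eq]] p_add[OF i]
        by (simp add: \<xi>_def)
      show "\<xi> i (x * y) = \<xi> i x * \<xi> i y"
        using p_mult[OF i, of "frag_of (x, 1)" "frag_of (y, 1)"] by (simp add: \<xi>_def)
      show "\<xi> i (scL r x) = scS r (\<xi> i x)"
        using p_cong[OF frag_scale[where r = r and a = x and b = 1], of i] p_pure[OF i] by (simp add: B.scale_mult_right)
      show "\<xi> i 1 = 1"
        using p_scalar[OF i] by (simp add: \<xi>_def)
    qed (use A.vector_space_axioms B.vector_space_axioms in auto)
    then show ?thesis
      by (simp add: alg_points_def)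
  qed
  have "\<exists>x. \<phi> (?cls x) = (\<lambda>i\<in>{..<n}. if i = j then 1 else 0)" for j
  proof -
    have "(\<lambda>i\<in>{..<n}. if i = j then 1 else 0) \<in> carrier (power_ring n :: (nat \<Rightarrow> 's) ring)"
      by (auto simp: power_ring_def)
    then have "(\<lambda>i\<in>{..<n}. if i = j then 1 else 0) \<in> \<phi> ` range ?cls"
      using bij_betw_imp_surj_on[OF bij] by (simp add: carrier_tensor_ring)
    then show ?thesis
      by (metis (no_types, lifting) image_iff)
  qed
  then obtain e where e: "\<And>j. \<phi> (?cls (e j)) = (\<lambda>i\<in>{..<n}. if i = j then 1 else 0)"
    by metis
  show thesis
  proof (rule that[of \<xi> e])
    show "eval_point (\<xi> i) (e j) = (if i = j then 1 else 0)" if "i < n" for i j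
      using p_eval[OF that, of "e j"] that by (simp add: p_def e)
    fix x assume x: "\<And>i. i < n \<Longrightarrow> eval_point (\<xi> i) x = 0"
    have "\<phi> (?cls x) = \<phi> (?cls 0)"
    proof (rule extensionalityI[OF \<phi>_ext \<phi>_ext])
      show "\<phi> (?cls x) i = \<phi> (?cls 0) i" if "i \<in> {..<n}" for i
        using that x[of i] p_eval[of i x] p_zero[of i] by (simp add: p_def)
    qed
    then have "?cls x = ?cls 0"
      using bij_betw_imp_inj_on[OF bij] by (simp add: inj_on_eq_iff)
    then show "x \<in> I"
      by (simp add: tensor_class_eq_iff)
  qed (use \<xi> in auto)
qed

lemma sum_idempotents:
  fixes scS :: "'f::field \<Rightarrow> 's::field \<Rightarrow> 's" and scL :: "'f \<Rightarrow> 'l::comm_ring_1 \<Rightarrow> 'l"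
    and n :: nat
  assumes \<xi>: "\<And>i. i < n \<Longrightarrow> \<xi> i \<in> alg_points scS scL"
    and e: "\<And>i j. i < n \<Longrightarrow> j < n \<Longrightarrow> eval_point (\<xi> i) (e j) = (if i = j then 1 else 0)"
    and ideal: "\<And>x. (\<And>i. i < n \<Longrightarrow> eval_point (\<xi> i) x = 0) \<Longrightarrow> x \<in> tensor_ideal scL scS"
  shows "(\<Sum>j<n. e j) - frag_of (1, 1) \<in> tensor_ideal scL scS"
proof (rule ideal)
  fix i assume i: "i < n"
  have "(\<Sum>j<n. eval_point (\<xi> i) (e j)) = (\<Sum>j<n. if i = j then 1 else 0)"
    by (rule sum.cong) (simp_all add: e i)
  also have "\<dots> = 1"
    using i by simp
  finally show "eval_point (\<xi> i) ((\<Sum>j<n. e j) - frag_of (1, 1)) = 0"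
    using algebra_homD(6)[of scL scS "\<xi> i"] \<xi>[OF i] by (simp add: eval_point_sum alg_points_def)
qed

text \<open>A point \<open>\<eta>\<close> sends the sum of the \<open>e j\<close> to 1, so it is
  nonzero on some \<open>e j\<close>. Since \<open>l \<otimes> 1\<close> and
  \<open>1 \<otimes> \<xi> j l\<close> agree after multiplication by \<open>e j\<close>, cancelling
  its value gives \<open>\<eta> l = \<xi> j l\<close>.\<close>

lemma alg_points_eq_image:
  fixes scS :: "'f::field \<Rightarrow> 's::field \<Rightarrow> 's" and scL :: "'f \<Rightarrow> 'l::comm_ring_1 \<Rightarrow> 'l"
    and n :: nat
  assumes alg: "assoc_algebra scS" "assoc_algebra scL"
    and \<xi>: "\<And>i. i < n \<Longrightarrow> \<xi> i \<in> alg_points scS scL"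
    and e: "\<And>i j. i < n \<Longrightarrow> j < n \<Longrightarrow> eval_point (\<xi> i) (e j) = (if i = j then 1 else 0)"
    and ideal: "\<And>x. (\<And>i. i < n \<Longrightarrow> eval_point (\<xi> i) x = 0) \<Longrightarrow> x \<in> tensor_ideal scL scS"
  shows "alg_points scS scL = \<xi> ` {..<n}" "inj_on \<xi> {..<n}"
proof -
  have hom1: "\<eta> 1 = 1" if "\<eta> \<in> alg_points scS scL" for \<eta>
    using that algebra_homD(6)[of scL scS \<eta>] by (simp add: alg_points_def)
  show "inj_on \<xi> {..<n}"
  proof (rule inj_onI, rule ccontr)
    fix i j assume "i \<in> {..<n}" "j \<in> {..<n}" "\<xi> i = \<xi> j" "i \<noteq> j"
    then show False
      using e[of i i] e[of j i] by auto
  qed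
  have "\<eta> \<in> \<xi> ` {..<n}" if \<eta>: "\<eta> \<in> alg_points scS scL" for \<eta>
  proof -
    have "(\<Sum>j<n. e j) - frag_of (1, 1) \<in> tensor_ideal scL scS"
      by (rule sum_idempotents[of n \<xi>]) (use \<xi> e ideal in blast)+
    then have "(\<Sum>j<n. eval_point \<eta> (e j)) = 1"
      using eval_point_ideal[OF alg(2,1) \<eta>] hom1[OF \<eta>] by (fastforce simp: eval_point_sum)
    then obtain j where j: "j < n" "eval_point \<eta> (e j) \<noteq> 0"
      by (metis lessThan_iff sum.neutral zero_neq_one)
    have "\<eta> l = \<xi> j l" for l
    proof -
      have "pair_mult (frag_of (l, 1)) (e j) - pair_mult (frag_of (1, \<xi> j l)) (e j) \<in> tensor_ideal scL scS"
        by (rule ideal) (simp add: eval_point_mult[OF \<xi>] e j hom1[OF \<xi>])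
      then have "\<eta> l * eval_point \<eta> (e j) = \<xi> j l * eval_point \<eta> (e j)"
        using eval_point_ideal[OF alg(2,1) \<eta>] hom1[OF \<eta>] by (fastforce simp: eval_point_mult[OF \<eta>])
      then show ?thesis
        using j(2) by simp
    qed
    then show ?thesis
      using j(1) by auto
  qed
  then show "alg_points scS scL = \<xi> ` {..<n}"
    using \<xi> by auto
qed


section \<open>Eigenspaces\<close>

lemma mem_eigen_ideal:
  "tensor_class scA scS x \<in> eigen_ideal scA scS \<epsilon> \<xi> \<longleftrightarrow>
     (\<forall>l. pair_mult (frag_of (1, \<xi> l)) x - pair_mult (frag_of (\<epsilon> l, 1)) x \<in> tensor_ideal scA scS)"
  by (simp add: eigen_ideal_def pure_tensor_eq_class tensor_class_mult tensor_class_eq_iff)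

lemma eigen_ideal_subset_carrier: "eigen_ideal scA scS \<epsilon> \<xi> \<subseteq> carrier (tensor_ring scA scS)"
  by (auto simp: eigen_ideal_def)

context scalar_extension
begin

section \<open>Galois conjugates of eigenspaces\<close>

lemma galois_tensor_map_ideal:
  "\<gamma> \<in> carrier (galois_group scS) \<Longrightarrow> x \<in> I \<Longrightarrow> tensor_map id \<gamma> x \<in> I"
  by (rule tensor_map_ideal) (auto simp: mem_galois_group intro: algebra_hom_id A.vector_space_axioms)

lemma galois_tensor_map_inverse:
  assumes "\<gamma> \<in> carrier (galois_group scS)"
  shows "tensor_map id \<gamma> (tensor_map id (inv_into UNIV \<gamma>) x) = (x :: 'a \<times> 's \<Rightarrow>\<^sub>0 int)"
    and "tensor_map id (inv_into UNIV \<gamma>) (tensor_map id \<gamma> x) = (x :: 'a \<times> 's \<Rightarrow>\<^sub>0 int)"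
proof -
  have "bij \<gamma>"
    using assms by (simp add: mem_galois_group)
  then have "\<gamma> \<circ> inv_into UNIV \<gamma> = id" "inv_into UNIV \<gamma> \<circ> \<gamma> = id"
    by (simp_all add: bij_is_inj bij_is_surj flip: surj_iff inj_iff)
  then show "tensor_map id \<gamma> (tensor_map id (inv_into UNIV \<gamma>) x) = x"
    "tensor_map id (inv_into UNIV \<gamma>) (tensor_map id \<gamma> x) = x"
    by (simp_all add: tensor_map_tensor_map)
qed

text \<open>Preservation of the ideal puts the image of a coset inside one coset; the inverse of
  \<open>\<gamma>\<close> shows that it fills that coset.\<close>

lemma gal_tensor_class:
  assumes \<gamma>: "\<gamma> \<in> carrier (galois_group scS)"
  shows "gal_tensor \<gamma> (cls x) = cls (tensor_map id \<gamma> x)"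
proof -
  have eq: "gal_tensor \<gamma> = image (tensor_map id \<gamma> :: ('a \<times> 's \<Rightarrow>\<^sub>0 int) \<Rightarrow> _)"
    by (simp add: gal_tensor_def tensor_map_def)
  let ?\<delta> = "inv_into UNIV \<gamma>"
  have "tensor_map id \<gamma> y \<in> cls (tensor_map id \<gamma> x)" if "y \<in> cls x" for y
    using galois_tensor_map_ideal[OF \<gamma>, of "y - x"] that
    by (simp add: mem_tensor_class tensor_map_diff)
  moreover have "y \<in> tensor_map id \<gamma> ` cls x" if "y \<in> cls (tensor_map id \<gamma> x)" for y
  proof -
    have "tensor_map id ?\<delta> y \<in> cls x"
      using galois_tensor_map_ideal[OF inv_galois_group[OF \<gamma>], of "y - tensor_map id \<gamma> x"] that
      by (simp add: mem_tensor_class tensor_map_diff galois_tensor_map_inverse[OF \<gamma>])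
    then show ?thesis
      using galois_tensor_map_inverse(1)[OF \<gamma>, of y] by (metis imageI)
  qed
  ultimately show ?thesis
    unfolding eq by blast
qed

text \<open>Applying \<open>id \<otimes> \<gamma>\<close> to the eigenvalue equation fixes
  \<open>\<epsilon> l \<otimes> 1\<close> and turns \<open>1 \<otimes> \<xi> l\<close> into
  \<open>1 \<otimes> \<gamma> (\<xi> l)\<close>.\<close>

lemma gal_tensor_eigen_ideal_subset:
  assumes \<gamma>: "\<gamma> \<in> carrier (galois_group scS)"
  shows "gal_tensor \<gamma> ` eigen_ideal scA scS \<epsilon> \<xi> \<subseteq> eigen_ideal scA scS \<epsilon> (\<gamma> \<circ> \<xi>)"
proof clarify
  fix Z assume Z: "Z \<in> eigen_ideal scA scS \<epsilon> \<xi>"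
  then obtain x where x: "Z = cls x"
    using eigen_ideal_subset_carrier by (fastforce simp: carrier_tensor_ring)
  have \<gamma>': "algebra_hom scS scS \<gamma>"
    using \<gamma> by (simp add: mem_galois_group)
  have "pair_mult (frag_of (1, \<gamma> (\<xi> l))) (tensor_map id \<gamma> x) -
      pair_mult (frag_of (\<epsilon> l, 1)) (tensor_map id \<gamma> x) \<in> I" for l
    using galois_tensor_map_ideal[OF \<gamma>, of "pair_mult (frag_of (1, \<xi> l)) x - pair_mult (frag_of (\<epsilon> l, 1)) x"]
      Z x algebra_homD[OF \<gamma>'] by (simp add: mem_eigen_ideal tensor_map_diff tensor_map_mult)
  then show "gal_tensor \<gamma> Z \<in> eigen_ideal scA scS \<epsilon> (\<gamma> \<circ> \<xi>)"
    by (simp add: x gal_tensor_class[OF \<gamma>] mem_eigen_ideal)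
qed

text \<open>The remaining inclusion is the previous one for the inverse of \<open>\<gamma>\<close>
  and the point \<open>\<gamma> \<circ> \<xi>\<close>.\<close>

lemma gal_tensor_eigen_ideal:
  assumes \<gamma>: "\<gamma> \<in> carrier (galois_group scS)"
  shows "eigen_ideal scA scS \<epsilon> (\<gamma> \<circ> \<xi>) = gal_tensor \<gamma> ` eigen_ideal scA scS \<epsilon> \<xi>"
proof
  let ?\<delta> = "inv_into UNIV \<gamma>"
  show "eigen_ideal scA scS \<epsilon> (\<gamma> \<circ> \<xi>) \<subseteq> gal_tensor \<gamma> ` eigen_ideal scA scS \<epsilon> \<xi>"
  proof
    fix Z assume Z: "Z \<in> eigen_ideal scA scS \<epsilon> (\<gamma> \<circ> \<xi>)"
    then obtain x where x: "Z = cls x"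
      using eigen_ideal_subset_carrier by (fastforce simp: carrier_tensor_ring)
    have "?\<delta> \<circ> (\<gamma> \<circ> \<xi>) = \<xi>"
      using \<gamma> by (auto simp: mem_galois_group bij_is_inj)
    then have "gal_tensor ?\<delta> Z \<in> eigen_ideal scA scS \<epsilon> \<xi>"
      using gal_tensor_eigen_ideal_subset[OF inv_galois_group[OF \<gamma>], of \<epsilon> "\<gamma> \<circ> \<xi>"] Z by auto
    moreover have "gal_tensor \<gamma> (gal_tensor ?\<delta> Z) = Z"
      by (simp add: x gal_tensor_class \<gamma> inv_galois_group galois_tensor_map_inverse[OF \<gamma>])
    ultimately show "Z \<in> gal_tensor \<gamma> ` eigen_ideal scA scS \<epsilon> \<xi>"
      by (metis imageI)
  qed
qed (rule gal_tensor_eigen_ideal_subset[OF \<gamma>])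

text \<open>The eigenvalue equation extends by additivity from \<open>l\<close> to every y in
  \<open>L\<^sub>s\<close>: the image of y acts on x as the scalar
  \<open>eval_point \<xi> y\<close>. Taking y = \<open>e\<close> gives x = e x. Conversely, the
  third hypothesis makes every right multiple of the image of \<open>e\<close> an
  eigenvector.\<close>

lemma eigen_ideal_eq:
  fixes scL :: "'f \<Rightarrow> 'l::comm_ring_1 \<Rightarrow> 'l"
  assumes \<epsilon>: "algebra_hom scL scA \<epsilon>"
    and \<xi>: "eval_point \<xi> e = 1"
    and e: "\<And>l. pair_mult (frag_of (1, \<xi> l)) e - pair_mult (frag_of (l, 1)) e \<in> tensor_ideal scL scS"
    and L: "assoc_algebra scL"
  shows "eigen_ideal scA scS \<epsilon> \<xi> = (\<otimes>\<^bsub>AS\<^esub>) (cls (tensor_map \<epsilon> id e)) ` carrier AS"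
proof -
  interpret L: algebra_pair scL scS
    by (intro algebra_pair.intro L B.assoc_algebra_axioms)
  note hom = algebra_homD[OF \<epsilon>]
  let ?E = "tensor_map \<epsilon> id"
  have mult: "?E (pair_mult x y) = pair_mult (?E x) (?E y)" for x y :: "'l \<times> 's \<Rightarrow>\<^sub>0 int"
    by (simp add: tensor_map_mult hom)
  have ideal: "?E x \<in> I" if "x \<in> tensor_ideal scL scS" for x
    by (rule L.tensor_map_ideal[OF \<epsilon> _ that]) (intro algebra_hom_id B.vector_space_axioms)
  have "Z \<in> (\<otimes>\<^bsub>AS\<^esub>) (cls (?E e)) ` carrier AS" if Z: "Z \<in> eigen_ideal scA scS \<epsilon> \<xi>" for Z
  proof -
    obtain x where x: "Z = cls x"
      using Z eigen_ideal_subset_carrier by (fastforce simp: carrier_tensor_ring)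
    have eig: "pair_mult (frag_of (1, \<xi> l)) x - pair_mult (frag_of (\<epsilon> l, 1)) x \<in> I" for l
      using Z x by (simp add: mem_eigen_ideal)
    have "pair_mult (frag_of (1, eval_point \<xi> y)) x - pair_mult (?E y) x \<in> I" for y
    proof (induction y rule: frag_induct)
      case zero
      then show ?case
        using mult_right_ideal[OF frag_zero_right] by simp
    next
      case (one l s)
      have "pair_mult (frag_of (1, s)) (pair_mult (frag_of (1, \<xi> l)) x - pair_mult (frag_of (\<epsilon> l, 1)) x) \<in> I"
        by (rule mult_left_ideal[OF eig])
      then show ?case
        by (simp add: pair_mult_diff_right mult.commute flip: pair_mult_assoc)
    next
      case (diff y z)
      let ?y = "eval_point \<xi> y" and ?z = "eval_point \<xi> z"
      have "pair_mult (frag_of (1, ?y - ?z) - (frag_of (1, ?y) - frag_of (1, ?z))) x \<in> I"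
        by (rule mult_right_ideal[OF frag_diff_right])
      from add_ideal[OF this diff_ideal[OF diff]] show ?case
        by (simp add: pair_mult_diff_left pair_mult_add_left tensor_map_diff algebra_simps)
    qed
    from this[of e] have "cls x = cls (pair_mult (?E e) x)"
      by (simp add: \<xi> pair_mult_one tensor_class_eq_iff)
    then show ?thesis
      by (auto simp: x tensor_class_mult[symmetric])
  qed
  moreover have "cls (?E e) \<otimes>\<^bsub>AS\<^esub> Z \<in> eigen_ideal scA scS \<epsilon> \<xi>" if "Z \<in> carrier AS" for Z
  proof -
    obtain x where x: "Z = cls x"
      using \<open>Z \<in> carrier AS\<close> by (auto simp: carrier_tensor_ring)
    have "pair_mult (?E (pair_mult (frag_of (1, \<xi> l)) e - pair_mult (frag_of (l, 1)) e)) x \<in> I" for l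
      by (rule mult_right_ideal[OF ideal[OF e]])
    then show ?thesis
      by (simp add: x tensor_class_mult mem_eigen_ideal tensor_map_diff mult hom
          pair_mult_diff_left flip: pair_mult_assoc)
  qed
  ultimately show ?thesis
    by auto
qed

end

lemma right_ideal_mult:
  fixes R :: "'r ring" (structure)
  assumes "ring R" and "e \<in> carrier R"
  shows "right_ideal ((\<otimes>) e ` carrier R) R"
proof -
  interpret ring R
    by fact
  have "subgroup ((\<otimes>) e ` carrier R) (add_monoid R)"
  proof (rule add.subgroupI)
    fix x y assume "x \<in> (\<otimes>) e ` carrier R" "y \<in> (\<otimes>) e ` carrier R"
    then obtain a b where ab: "a \<in> carrier R" "b \<in> carrier R" "x = e \<otimes> a" "y = e \<otimes> b"
      by auto
    then have "\<ominus> x = e \<otimes> (\<ominus> a)" "x \<oplus> y = e \<otimes> (a \<oplus> b)"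
      using assms by (simp_all add: r_minus r_distr)
    then show "\<ominus> x \<in> (\<otimes>) e ` carrier R" "x \<oplus> y \<in> (\<otimes>) e ` carrier R"
      using ab by auto
  qed (use assms in auto)
  then show ?thesis
    using assms by (auto simp: right_ideal_def additive_subgroup_def m_assoc)
qed

theorem proposition2p6:
  fixes scS :: "'f::field \<Rightarrow> 's::field \<Rightarrow> 's"
    and scL :: "'f \<Rightarrow> 'l::comm_ring_1 \<Rightarrow> 'l"
    and scA :: "'f \<Rightarrow> 'a::ring_1 \<Rightarrow> 'a"
    and \<epsilon> :: "'l \<Rightarrow> 'a"
    and n :: nat
  assumes "separable_closure scS"
    and "n \<ge> 1"
    and "etale scS scL n"
    and "central_simple scA n"
    and "algebra_hom scL scA \<epsilon>"
    and "inj \<epsilon>"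
  shows "(\<forall>\<xi>\<in>alg_points scS scL.
            right_ideal (eigen_ideal scA scS \<epsilon> \<xi>) (tensor_ring scA scS) \<and>
            ring.dimension (tensor_ring scA scS) n (ext_scalars scA scS)
              (eigen_ideal scA scS \<epsilon> \<xi>)) \<and>
         general_embedding scA scS n (alg_points scS scL) (alg_points_action scS scL)
           (eigen_ideal scA scS \<epsilon>)"
proof -
  have S: "assoc_algebra scS" and L: "assoc_algebra scL" and A: "assoc_algebra scA"
    using assms by (auto simp: separable_closure_def etale_def central_simple_def)
  interpret scalar_extension scA scS
    by (intro scalar_extension.intro algebra_pair.intro A S)
  interpret L: algebra_pair scL scS
    by (intro algebra_pair.intro L S)
  obtain \<xi> e where \<xi>: "\<And>i. i < n \<Longrightarrow> \<xi> i \<in> alg_points scS scL"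
    and e: "\<And>i j. i < n \<Longrightarrow> j < n \<Longrightarrow> eval_point (\<xi> i) (e j) = (if i = j then 1 else 0)"
    and ideal: "\<And>x. (\<And>i. i < n \<Longrightarrow> eval_point (\<xi> i) x = 0) \<Longrightarrow> x \<in> tensor_ideal scL scS"
    using etale_idempotents[OF S assms(3)] by blast
  have points: "alg_points scS scL = \<xi> ` {..<n}" "inj_on \<xi> {..<n}"
    by (rule alg_points_eq_image[OF S L]; use \<xi> e ideal in blast)+
  have hom1: "\<xi> i 1 = 1" if "i < n" for i
    using \<xi>[OF that] algebra_homD(6)[of scL scS "\<xi> i"] by (simp add: alg_points_def)
  note hom = algebra_homD[OF assms(5)]
  note eval_mult = eval_point_mult[OF \<xi>]

  \<comment> \<open>The homomorphism \<open>\<epsilon> \<otimes> id\<close> on representatives: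
    identities among the idempotents are verified in \<open>L\<^sub>s\<close> by evaluation and
    transported along it.\<close>
  define E where "E = (tensor_map \<epsilon> id :: ('l \<times> 's \<Rightarrow>\<^sub>0 int) \<Rightarrow> _)"
  have E_mult: "E (pair_mult x y) = pair_mult (E x) (E y)" for x y
    by (simp add: E_def tensor_map_mult hom)
  have E_ideal: "E x \<in> I" if "x \<in> tensor_ideal scL scS" for x
    unfolding E_def
    by (rule L.tensor_map_ideal[OF assms(5) _ that]) (intro algebra_hom_id B.vector_space_axioms)
  have E_cong: "cls (E x) = cls (E y)" if "x - y \<in> tensor_ideal scL scS" for x y
    using E_ideal[OF that] by (simp add: tensor_class_eq_iff E_def tensor_map_diff)

  define f where "f i = cls (E (e i))" for i
  have f_carrier: "f i \<in> carrier AS" for i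
    by (simp add: f_def)
  have f_mult: "f i \<otimes>\<^bsub>AS\<^esub> f j = (if i = j then f i else \<zero>\<^bsub>AS\<^esub>)" if ij: "i < n" "j < n" for i j
  proof -
    have "pair_mult (e i) (e j) - (if i = j then e i else 0) \<in> tensor_ideal scL scS"
      by (rule ideal) (use ij in \<open>auto simp: eval_mult e\<close>)
    then have "cls (E (pair_mult (e i) (e j))) = cls (E (if i = j then e i else 0))"
      by (rule E_cong)
    then show ?thesis
      by (simp add: f_def tensor_class_simps E_mult) (simp add: E_def)
  qed
  have sum_one: "cls (E (\<Sum>j<n. e j)) = \<one>\<^bsub>AS\<^esub>"
  proof -
    have "(\<Sum>j<n. e j) - frag_of (1, 1) \<in> tensor_ideal scL scS"
      by (rule sum_idempotents[of n \<xi>]) (use \<xi> e ideal in blast)+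
    then have "cls (E (\<Sum>j<n. e j)) = cls (E (frag_of (1, 1)))"
      by (rule E_cong)
    then show ?thesis
      by (simp add: E_def hom tensor_ring_one)
  qed
  \<comment> \<open>Injectivity of \<open>\<epsilon>\<close> enters here. A linear left inverse
    \<open>g\<close> exists over a field but need not be multiplicative, so
    \<open>(\<xi> i \<circ> g) \<otimes> id\<close> is used only as an additive function; it takes
    the value 1 at the image of \<open>e i\<close>.\<close>
  have f_nonzero: "E (e i) \<notin> I" if i: "i < n" for i
  proof
    assume "E (e i) \<in> I"
    interpret AL: vector_space_pair scL scA
      by (intro vector_space_pair.intro A.vector_space_axioms L.A.vector_space_axioms)
    obtain g where g: "Vector_Spaces.linear scA scL g" "g \<circ> \<epsilon> = id"
      using AL.linear_injective_left_inverse[of \<epsilon>] assms(5,6) by (auto simp: algebra_hom_def)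
    note \<xi>_hom = algebra_homD[of scL scS "\<xi> i"]
    have g_eps: "g (\<epsilon> l) = l" for l
      using g(2) by (simp add: fun_eq_iff)
    have "balanced scA scS (\<lambda>(a, s). \<xi> i (g a) * s)"
      using g(1) \<xi>_hom \<xi>[OF i]
      by (simp add: balanced_def alg_points_def Vector_Spaces.linear_iff algebra_simps
          B.scale_mult_left B.scale_mult_right)
    then have "pair_extend (\<lambda>(a, s). \<xi> i (g a) * s) (E (e i)) = 0"
      using \<open>E (e i) \<in> I\<close> pair_extend_ideal by blast
    moreover have "pair_extend (\<lambda>(a, s). \<xi> i (g a) * s) (E (e i)) = eval_point (\<xi> i) (e i)"
      by (simp add: E_def pair_extend_tensor_map eval_point_def g_eps)
    ultimately show False
      using e[OF i i] by simp
  qed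
  have eigen: "eigen_ideal scA scS \<epsilon> (\<xi> i) = (\<otimes>\<^bsub>AS\<^esub>) (f i) ` carrier AS" if i: "i < n" for i
    unfolding f_def E_def
  proof (rule eigen_ideal_eq[OF assms(5) _ _ L])
    show "eval_point (\<xi> i) (e i) = 1"
      using e[OF i i] by simp
    show "pair_mult (frag_of (1, \<xi> i l)) (e i) - pair_mult (frag_of (l, 1)) (e i) \<in> tensor_ideal scL scS" for l
      by (rule ideal) (simp add: eval_mult e i hom1)
  qed

  have dimA: "A.dim UNIV = n\<^sup>2"
    using assms(4) by (simp add: central_simple_def)
  \<comment> \<open>\<open>card\<close> is 0 on infinite sets, so the positive value
    \<open>n\<^sup>2\<close> makes the basis finite.\<close>
  have "card (A.extend_basis {}) = n\<^sup>2"
    using A.dim_eq_card[of "A.extend_basis {}" UNIV] A.extend_basis_empty A.span_UNIV dimA by simp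
  then have "finite (A.extend_basis {})"
    using assms(2) by (intro card_ge_0_finite) simp
  then have dimAS: "AS.dimension (n\<^sup>2) (ext_scalars scA scS) (carrier AS)"
    using dimension_carrier dimA by simp
  have prime: "\<exists>z\<in>carrier AS. f i \<otimes>\<^bsub>AS\<^esub> z \<otimes>\<^bsub>AS\<^esub> f j \<noteq> \<zero>\<^bsub>AS\<^esub>" if ij: "i < n" "j < n" for i j
  proof -
    obtain z where "pair_mult (pair_mult (E (e i)) z) (E (e j)) \<notin> I"
      using tensor_prime[OF assms(4) f_nonzero[OF ij(1)] f_nonzero[OF ij(2)]] by blast
    then show ?thesis
      by (intro bexI[of _ "cls z"]) (simp_all add: f_def tensor_class_simps tensor_class_eq_iff)
  qed
  have right: "right_ideal (eigen_ideal scA scS \<epsilon> (\<xi> i)) AS"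
    and dim: "AS.dimension n (ext_scalars scA scS) (eigen_ideal scA scS \<epsilon> (\<xi> i))" if "i < n" for i
  proof -
    show "right_ideal (eigen_ideal scA scS \<epsilon> (\<xi> i)) AS"
      by (simp add: eigen that right_ideal_mult AS.ring_axioms f_carrier)
    show "AS.dimension n (ext_scalars scA scS) (eigen_ideal scA scS \<epsilon> (\<xi> i))"
      unfolding eigen[OF that]
      by (rule AS.dimension_idempotent_ideal[OF subfield_ext_scalars ext_scalars_central dimAS])
        (use f_carrier f_mult prime that in simp_all)
  qed

  have f_mem: "f i \<in> eigen_ideal scA scS \<epsilon> (\<xi> i)" if "i < n" for i
    unfolding eigen[OF that] by (rule image_eqI[of _ _ "\<one>\<^bsub>AS\<^esub>"]) (simp_all add: f_carrier)
  have inj: "i = j" if ij: "i < n" "j < n"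
    and eq: "eigen_ideal scA scS \<epsilon> (\<xi> i) = eigen_ideal scA scS \<epsilon> (\<xi> j)" for i j
  proof (rule ccontr)
    assume "i \<noteq> j"
    \<comment> \<open>Left multiplication by \<open>f j\<close> is the identity on the common ideal,
      which contains \<open>f i\<close>; but orthogonality makes it kill \<open>f i\<close>.\<close>
    obtain x where x: "x \<in> carrier AS" "f i = f j \<otimes>\<^bsub>AS\<^esub> x"
      using f_mem[OF ij(1)] eigen[OF ij(2)] eq by auto
    have "f j \<otimes>\<^bsub>AS\<^esub> f i = f i"
      unfolding x(2) using x(1) f_carrier f_mult[OF ij(2) ij(2)] by (simp add: AS.m_assoc[symmetric])
    then have "f i = \<zero>\<^bsub>AS\<^esub>"
      using f_mult[OF ij(2,1)] \<open>i \<noteq> j\<close> by simp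
    then show False
      using f_nonzero[OF ij(1)] by (simp add: f_def tensor_ring_zero tensor_class_eq_iff)
  qed
  have inj_on: "inj_on (eigen_ideal scA scS \<epsilon>) (alg_points scS scL)"
    unfolding points(1) by (rule inj_onI) (use inj in auto)
  have card: "card (alg_points scS scL) = n"
    using points(2) by (simp add: points(1) card_image)
  have galois: "galois_set scS n (alg_points scS scL) (alg_points_action scS scL)"
    using galois_set_alg_points[OF B.vector_space_axioms, of scL] card points(1) by simp
  have general: "general_position scA scS n (eigen_ideal scA scS \<epsilon> ` alg_points scS scL)"
    unfolding general_position_def
  proof (intro ballI impI)
    fix k J assume J: "J \<in> SB_linear scA scS n k"
      and sub: "\<forall>M\<in>eigen_ideal scA scS \<epsilon> ` alg_points scS scL. M \<subseteq> J"
    have R: "right_ideal J AS"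
      using J by (simp add: SB_linear_def)
    then interpret J: additive_subgroup J AS
      by (simp add: right_ideal_def)
    \<comment> \<open>\<open>J\<close> contains every \<open>f j\<close>, hence their sum 1, and a
      right ideal containing 1 is everything. Partial sums allow one \<open>f j\<close> to be added
      at a time.\<close>
    have "cls (E (\<Sum>j\<in>K. e j)) \<in> J" if "K \<subseteq> {..<n}" for K
      using that
    proof (induction K rule: infinite_finite_induct)
      case (insert j K)
      have "f j \<in> J"
        using f_mem[of j] sub \<xi>[of j] insert.prems by auto
      then show ?case
        using insert J.a_closed[of "f j"]
        by (simp add: f_def E_def tensor_map_add flip: tensor_class_add)
    qed (use J.zero_closed in \<open>simp_all add: E_def tensor_ring_zero\<close>)
    from this[OF subset_refl] have "\<one>\<^bsub>AS\<^esub> \<in> J"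
      by (simp only: sum_one)
    then have "x \<in> J" if "x \<in> carrier AS" for x
      using R that AS.l_one[of x] unfolding right_ideal_def by metis
    then show "J = carrier AS"
      using J.a_subset by blast
  qed
  have equi: "eigen_ideal scA scS \<epsilon> (alg_points_action scS scL \<gamma> \<eta>) =
      gal_tensor \<gamma> ` eigen_ideal scA scS \<epsilon> \<eta>"
    if "\<gamma> \<in> carrier (galois_group scS)" "\<eta> \<in> alg_points scS scL" for \<gamma> \<eta>
    using that by (simp add: alg_points_action_def gal_tensor_eigen_ideal)
  have "eigen_ideal scA scS \<epsilon> ` alg_points scS scL \<subseteq> SB_points scA scS n"
    using right dim by (auto simp: points(1) SB_linear_def)
  then have "general_embedding scA scS n (alg_points scS scL) (alg_points_action scS scL)
      (eigen_ideal scA scS \<epsilon>)"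
    using galois inj_on equi general card card_image[OF inj_on] by (simp add: general_embedding_def)
  moreover have "\<forall>\<eta>\<in>alg_points scS scL.
      right_ideal (eigen_ideal scA scS \<epsilon> \<eta>) AS \<and>
      AS.dimension n (ext_scalars scA scS) (eigen_ideal scA scS \<epsilon> \<eta>)"
    using right dim by (auto simp: points(1))
  ultimately show ?thesis
    by blast
qed

end
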